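(* Let $G$ be a countable, discrete, residually finite group. Consider the action of $G$ on itself by right multiplication and fix a proper, right-invariant metric on $G$. Let $\sigma=(G_n)_n$ be a decreasing sequence of finite-index subgroups of $G$. Then the following conditions are equivalent for all $s\in\mathbb N$: (1) $\sigma$ is semi-conjugacy-separating and the box space $\square_\sigma G$ has asymptotic dimension at most $s$. (2) For any $R>0$, there exist $n$ and a uniformly bounded cover $\mathcal U=\mathcal U^{(0)}\cup\dots\cup\mathcal U^{(s)}$ of $G$ with Lebesgue number at least $R$, such that each $\mathcal U^{(l)}$ is $G_n$-invariant (with regard to the right multiplication) and has mutually disjoint members. (3) For every $\varepsilon>0$ and every finite subset $M\subset G$, there exist $n$ and finitely supported functions $\mu^{(l)}:G\to[0,1]$ for $l=0,\dots,s$ satisfying the following properties: (a) for every $l=0,\dots,s$, one has $\operatorname{supp}(\mu^{(l)})\cap\operatorname{supp}(\mu^{(l)})h=\varnothing$ for all $h\in G_n\setminus\{1\}$; (b) for every $g\in G$, one has $\sum_{l=0}^s\sum_{h\in G_n}\mu^{(l)}(gh)=1$; (c) for every $l=0,\dots,s$ and $g\in M$, one has $\sup_{x\in G}|\mu^{(l)}(x)-\mu^{(l)}(gx)|\le\varepsilon$.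
   Context: A metric on a discrete set is proper if all balls are finite. A decreasing sequence $\sigma=(G_n)_n$ of finite-index subgroups of $G$ is semi-conjugacy-separating if for every $g\in G\setminus\{1\}$ there is $n$ with $G_n\cap g^GG_n=\varnothing$, where $g^G$ is the conjugacy class of $g$. A cover has Lebesgue number at least $R$ if every subset of diameter less than $R$ is contained in a member of the cover. A collection $\mathcal U^{(l)}$ of subsets of $G$ is $G_n$-invariant with regard to right multiplication if $Uh\in\mathcal U^{(l)}$ for all $U\in\mathcal U^{(l)}$ and $h\in G_n$; it has mutually disjoint members if any two distinct members are disjoint. Box space: with $d$ a proper right-invariant metric on $G$, put on $G/G_n$ (left cosets) the quotient metric $d_n(xG_n,yG_n)=\inf\{d(xh_1,yh_2): h_1,h_2\in G_n\}$. The box space $\square_\sigma G$ is the set $\bigsqcup_n G/G_n$ with a metric $d^B$ restricting to $d_n$ on each $G/G_n$ and with $\operatorname{dist}_{d^B}(G/G_n,G/G_m)\to\infty$ as $n\neq m$, $n+m\to\infty$. Its coarse equivalence class does not depend on the choice of $d$ and $d^B$. Asymptotic dimension: for a metric space $X$, $\operatorname{asdim}(X)$ is the smallest non-negative integer $s$ ($\infty$ if none) such that for every $R>0$ there is a uniformly bounded cover $\mathcal V=\mathcal V^{(0)}\cup\dots\cup\mathcal V^{(s)}$ of $X$ with Lebesgue number at least $R$ such that each $\mathcal V^{(l)}$ consists of pairwise disjoint sets.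
   Formalization: Condition (2) additionally requires U ∩ Uh = ∅ for every member U of U^(l) and every h in G_n other than 1; without this, G = Z/2 with G_n = G, s = 0 and the cover {G} satisfies (2) but neither (1) nor (3). *)

theory Defs
  imports "HOL-Analysis.Analysis" "HOL-Algebra.Left_Coset"
begin

section \<open>Groups\<close>

definition finite_index_subgroup :: "('a, 'b) monoid_scheme \<Rightarrow> 'a set \<Rightarrow> bool" where
  "finite_index_subgroup G H \<longleftrightarrow> subgroup H G \<and> finite (lcosets\<^bsub>G\<^esub> H)"

definition residually_finite :: "('a, 'b) monoid_scheme \<Rightarrow> bool" where
  "residually_finite G \<longleftrightarrow>
     (\<forall>g\<in>carrier G - {\<one>\<^bsub>G\<^esub>}. \<exists>N. N \<lhd> G \<and> finite_index_subgroup G N \<and> g \<notin> N)"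

definition conj_class :: "('a, 'b) monoid_scheme \<Rightarrow> 'a \<Rightarrow> 'a set" where
  "conj_class G g = {x \<otimes>\<^bsub>G\<^esub> g \<otimes>\<^bsub>G\<^esub> inv\<^bsub>G\<^esub> x | x. x \<in> carrier G}"

definition semi_conjugacy_separating ::
    "('a, 'b) monoid_scheme \<Rightarrow> (nat \<Rightarrow> 'a set) \<Rightarrow> bool" where
  "semi_conjugacy_separating G \<sigma> \<longleftrightarrow>
     (\<forall>g\<in>carrier G - {\<one>\<^bsub>G\<^esub>}. \<exists>n. \<sigma> n \<inter> (conj_class G g <#>\<^bsub>G\<^esub> \<sigma> n) = {})"

definition right_invariant_family ::
    "('a, 'b) monoid_scheme \<Rightarrow> 'a set \<Rightarrow> 'a set set \<Rightarrow> bool" where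
  "right_invariant_family G H \<U> \<longleftrightarrow> (\<forall>U\<in>\<U>. \<forall>h\<in>H. U #>\<^bsub>G\<^esub> h \<in> \<U>)"


section \<open>Metrics, covers and asymptotic dimension\<close>

definition proper_right_invariant_metric ::
    "('a, 'b) monoid_scheme \<Rightarrow> ('a \<Rightarrow> 'a \<Rightarrow> real) \<Rightarrow> bool" where
  "proper_right_invariant_metric G d \<longleftrightarrow>
     Metric_space (carrier G) d \<and>
     (\<forall>x\<in>carrier G. \<forall>r. finite (Metric_space.mball (carrier G) d x r)) \<and>
     (\<forall>x\<in>carrier G. \<forall>y\<in>carrier G. \<forall>g\<in>carrier G. d (x \<otimes>\<^bsub>G\<^esub> g) (y \<otimes>\<^bsub>G\<^esub> g) = d x y)"

text \<open>With values in \<^typ>\<open>ennreal\<close>, unbounded sets have diameter \<open>\<infinity>\<close> and the empty set has diameter 0.\<close>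

definition diam :: "('a \<Rightarrow> 'a \<Rightarrow> real) \<Rightarrow> 'a set \<Rightarrow> ennreal" where
  "diam d S = (SUP (x, y)\<in>S \<times> S. ennreal (d x y))"

definition cover_of :: "'a set \<Rightarrow> 'a set set \<Rightarrow> bool" where
  "cover_of X \<U> \<longleftrightarrow> \<Union>\<U> = X"

definition uniformly_bounded :: "('a \<Rightarrow> 'a \<Rightarrow> real) \<Rightarrow> 'a set set \<Rightarrow> bool" where
  "uniformly_bounded d \<U> \<longleftrightarrow> (\<exists>D::real. \<forall>U\<in>\<U>. diam d U \<le> ennreal D)"

definition lebesgue_number_at_least ::
    "'a set \<Rightarrow> ('a \<Rightarrow> 'a \<Rightarrow> real) \<Rightarrow> 'a set set \<Rightarrow> real \<Rightarrow> bool" where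
  "lebesgue_number_at_least X d \<U> R \<longleftrightarrow>
     (\<forall>S\<subseteq>X. diam d S < ennreal R \<longrightarrow> (\<exists>U\<in>\<U>. S \<subseteq> U))"

definition asdim :: "'a set \<Rightarrow> ('a \<Rightarrow> 'a \<Rightarrow> real) \<Rightarrow> enat" where
  "asdim X d = Inf {enat s | s. \<forall>R>0. \<exists>\<V>.
     cover_of X (\<Union>l\<le>s. \<V> l) \<and>
     uniformly_bounded d (\<Union>l\<le>s. \<V> l) \<and>
     lebesgue_number_at_least X d (\<Union>l\<le>s. \<V> l) R \<and>
     (\<forall>l\<le>s. disjoint (\<V> l))}"


section \<open>Box spaces\<close>

definition box_space :: "('a, 'b) monoid_scheme \<Rightarrow> (nat \<Rightarrow> 'a set) \<Rightarrow> (nat \<times> 'a set) set" where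
  "box_space G \<sigma> = (SIGMA n:UNIV. lcosets\<^bsub>G\<^esub> (\<sigma> n))"

definition set_dist :: "('a \<Rightarrow> 'a \<Rightarrow> real) \<Rightarrow> 'a set \<Rightarrow> 'a set \<Rightarrow> real" where
  "set_dist d A B = (INF (a, b)\<in>A \<times> B. d a b)"

text \<open>The quotient metric of two cosets \<open>A = xH\<close> and \<open>B = yH\<close> is their distance \<open>set_dist d A B\<close>
  as subsets of the group.\<close>

definition box_metric ::
    "('a, 'b) monoid_scheme \<Rightarrow> ('a \<Rightarrow> 'a \<Rightarrow> real) \<Rightarrow> (nat \<Rightarrow> 'a set) \<Rightarrow>
      (nat \<times> 'a set \<Rightarrow> nat \<times> 'a set \<Rightarrow> real) \<Rightarrow> bool" where
  "box_metric G d \<sigma> \<rho> \<longleftrightarrow>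
     Metric_space (box_space G \<sigma>) \<rho> \<and>
     (\<forall>n. \<forall>A\<in>lcosets\<^bsub>G\<^esub> (\<sigma> n). \<forall>B\<in>lcosets\<^bsub>G\<^esub> (\<sigma> n). \<rho> (n, A) (n, B) = set_dist d A B) \<and>
     (\<forall>C. \<exists>N. \<forall>n m. n \<noteq> m \<longrightarrow> n + m \<ge> N \<longrightarrow>
        set_dist \<rho> ({n} \<times> lcosets\<^bsub>G\<^esub> (\<sigma> n)) ({m} \<times> lcosets\<^bsub>G\<^esub> (\<sigma> m)) \<ge> C)"

lemma set_dist_commute:
  assumes "\<And>x y. d x y = d y x"
  shows "set_dist d A B = set_dist d B A"
proof -
  have "(\<lambda>(a, b). d a b) ` (A \<times> B) = (\<lambda>(a, b). d a b) ` (B \<times> A)"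
    using assms by (force simp: image_iff)
  then show ?thesis by (simp add: set_dist_def)
qed

lemma set_dist_nonneg:
  assumes "\<And>x y. 0 \<le> d x y" "A \<noteq> {}" "B \<noteq> {}"
  shows "0 \<le> set_dist d A B"
  unfolding set_dist_def using assms by (intro cINF_greatest) auto

lemma set_dist_le:
  assumes "\<And>x y. 0 \<le> d x y" "a \<in> A" "b \<in> B"
  shows "set_dist d A B \<le> d a b"
proof -
  have "bdd_below ((\<lambda>(a, b). d a b) ` (A \<times> B))"
    using assms(1) by (intro bdd_belowI[of _ 0]) auto
  then show ?thesis
    unfolding set_dist_def using assms(2,3) cINF_lower[of "\<lambda>(a, b). d a b" "A \<times> B" "(a, b)"] by auto
qed

lemma set_dist_attained:
  assumes G: "group G" and H: "subgroup H G" and d: "proper_right_invariant_metric G d"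
    and A: "A \<in> lcosets\<^bsub>G\<^esub> H" and B: "B \<in> lcosets\<^bsub>G\<^esub> H" and a: "a \<in> A"
  shows "\<exists>b\<in>B. set_dist d A B = d a b"
proof -
  interpret group G by fact
  interpret H: subgroup H G by fact
  interpret Metric_space "carrier G" d
    using d by (simp add: proper_right_invariant_metric_def)
  have AG: "A \<subseteq> carrier G" and BG: "B \<subseteq> carrier G"
    using A B H.lcosets_carrier[OF G] by auto
  obtain y where y: "y \<in> carrier G" "B = y <#\<^bsub>G\<^esub> H" using B by (auto simp: LCOSETS_def)
  obtain x where x: "x \<in> carrier G" "A = x <#\<^bsub>G\<^esub> H" using A by (auto simp: LCOSETS_def)
  have yB: "y \<in> B" using y lcos_self H by auto
  define F where "F = B \<inter> mball a (d a y + 1)"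
  have "finite F" "y \<in> F"
    using d a AG yB BG by (auto simp: F_def proper_right_invariant_metric_def)
  then obtain b where b: "b \<in> F" "\<And>c. c \<in> F \<Longrightarrow> d a b \<le> d a c"
    using arg_min_if_finite[of F "d a"] by (metis empty_iff linorder_not_less)
  have min: "d a b \<le> d a c" if "c \<in> B" for c
  proof (cases "c \<in> F")
    case False
    then have "d a c \<ge> d a y + 1" using that a AG BG by (auto simp: F_def)
    then show ?thesis using b(2)[OF \<open>y \<in> F\<close>] by linarith
  qed (use b in auto)
  have le: "d a b \<le> d a' b'" if ab: "a' \<in> A" "b' \<in> B" for a' b'
  proof -
    obtain h1 h2 h3 where h: "h1 \<in> H" "a = x \<otimes>\<^bsub>G\<^esub> h1" "h2 \<in> H" "a' = x \<otimes>\<^bsub>G\<^esub> h2"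
        "h3 \<in> H" "b' = y \<otimes>\<^bsub>G\<^esub> h3"
      using a ab x y unfolding l_coset_def by blast
    let ?k = "inv\<^bsub>G\<^esub> h2 \<otimes>\<^bsub>G\<^esub> h1"
    have k: "?k \<in> H" using h by auto
    have "a' \<otimes>\<^bsub>G\<^esub> ?k = a"
      using h x by (simp add: m_assoc inv_solve_left flip: m_assoc) (simp add: m_assoc)
    moreover have "b' \<otimes>\<^bsub>G\<^esub> ?k \<in> B"
    proof -
      have "b' \<otimes>\<^bsub>G\<^esub> ?k = y \<otimes>\<^bsub>G\<^esub> (h3 \<otimes>\<^bsub>G\<^esub> ?k)" using h y k by (simp add: m_assoc)
      then show ?thesis using h k y unfolding l_coset_def by blast
    qed
    ultimately have "d a b \<le> d (a' \<otimes>\<^bsub>G\<^esub> ?k) (b' \<otimes>\<^bsub>G\<^esub> ?k)" using min by simp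
    also have "\<dots> = d a' b'"
      using d ab AG BG k H.subset unfolding proper_right_invariant_metric_def by blast
    finally show ?thesis .
  qed
  have bB: "b \<in> B" using b by (simp add: F_def)
  have "set_dist d A B \<le> d a b" using a bB by (intro set_dist_le) auto
  moreover have "d a b \<le> set_dist d A B"
    unfolding set_dist_def using a bB le by (intro cINF_greatest) auto
  ultimately show ?thesis using bB by force
qed

lemma lcosets_eq_if_meet:
  assumes G: "group G" and H: "subgroup H G"
    and "A \<in> lcosets\<^bsub>G\<^esub> H" "B \<in> lcosets\<^bsub>G\<^esub> H" "a \<in> A" "a \<in> B"
  shows "A = B"
  using assms(3-6) group.l_repr_independence[OF G _ _ H] unfolding LCOSETS_def
  by (metis (no_types, lifting) UN_E singletonD)

lemma ex_box_metric:
  assumes G: "group G" and d: "proper_right_invariant_metric G d"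
    and \<sigma>: "\<And>n. subgroup (\<sigma> n) G"
  shows "\<exists>\<rho>. box_metric G d \<sigma> \<rho>"
proof -
  interpret group G by fact
  interpret Metric_space "carrier G" d
    using d by (simp add: proper_right_invariant_metric_def)
  let ?L = "\<lambda>n. lcosets\<^bsub>G\<^esub> (\<sigma> n)"
  have ne: "A \<noteq> {}" if "A \<in> ?L n" for A n
    using that lcos_self[OF _ \<sigma>] by (fastforce simp: LCOSETS_def)
  have base: "\<sigma> n \<in> ?L n" for n
  proof -
    have "\<sigma> n = \<one>\<^bsub>G\<^esub> <#\<^bsub>G\<^esub> \<sigma> n"
      using lcos_mult_one[OF subgroup.subset[OF \<sigma>]] by simp
    then show ?thesis by (auto simp: LCOSETS_def)
  qed
  have nn: "0 \<le> set_dist d A B" if "A \<in> ?L n" "B \<in> ?L n" for A B n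
    using that ne by (intro set_dist_nonneg) auto
  have sym: "set_dist d A B = set_dist d B A" for A B
    by (rule set_dist_commute) (rule commute)
  have tri: "set_dist d A C \<le> set_dist d A B + set_dist d B C"
    if ABC: "A \<in> ?L n" "B \<in> ?L n" "C \<in> ?L n" for A B C n
  proof -
    obtain a where a: "a \<in> A" using ne ABC by blast
    obtain b where b: "b \<in> B" "set_dist d A B = d a b"
      using set_dist_attained[OF G \<sigma> d] ABC a by blast
    obtain c where c: "c \<in> C" "set_dist d B C = d b c"
      using set_dist_attained[OF G \<sigma> d] ABC b by blast
    have "set_dist d A C \<le> d a c" using a c by (intro set_dist_le) auto
    also have "\<dots> \<le> d a b + d b c"
      using a b c ABC subgroup.lcosets_carrier[OF \<sigma> G] by (intro triangle) blast+
    finally show ?thesis using b c by simp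
  qed
  have zero': "set_dist d A B = 0 \<longleftrightarrow> A = B" if AB: "A \<in> ?L n" "B \<in> ?L n" for A B n
  proof -
    obtain a where a: "a \<in> A" using ne AB by blast
    obtain b where b: "b \<in> B" "set_dist d A B = d a b"
      using set_dist_attained[OF G \<sigma> d] AB a by blast
    have inG: "a \<in> carrier G" "b \<in> carrier G"
      using a b AB subgroup.lcosets_carrier[OF \<sigma> G] by blast+
    show ?thesis
    proof
      assume "set_dist d A B = 0"
      then have "a = b" using b inG by simp
      then show "A = B" using lcosets_eq_if_meet[OF G \<sigma>] AB a b by blast
    next
      assume "A = B"
      then have "set_dist d A B \<le> d a a" using a by (intro set_dist_le) auto
      then show "set_dist d A B = 0" using nn[OF AB] inG by simp
    qed
  qed
  define \<rho>' where "\<rho>' = (\<lambda>(n, A) (m, B). if n = m then set_dist d A B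
     else set_dist d A (\<sigma> n) + set_dist d B (\<sigma> m) + (real n + real m))"
  define \<rho> where "\<rho> = (\<lambda>p q. if p \<in> box_space G \<sigma> \<and> q \<in> box_space G \<sigma> then \<rho>' p q else 0)"
  have X: "(n, A) \<in> box_space G \<sigma> \<longleftrightarrow> A \<in> ?L n" for n A by (simp add: box_space_def)
  have "Metric_space (box_space G \<sigma>) \<rho>"
  proof
    show "0 \<le> \<rho> p q" for p q
      using nn base by (cases p; cases q) (auto simp: \<rho>_def \<rho>'_def X)
    show "\<rho> p q = \<rho> q p" for p q
      using sym by (cases p; cases q) (auto simp: \<rho>_def \<rho>'_def X)
    show "(\<rho> p q = 0) = (p = q)" if "p \<in> box_space G \<sigma>" "q \<in> box_space G \<sigma>" for p q
    proof (cases p; cases q)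
      fix n A m B assume pq: "p = (n, A)" "q = (m, B)"
      have AB: "A \<in> ?L n" "B \<in> ?L m" using that pq X by auto
      show ?thesis
      proof (cases "n = m")
        case True
        then show ?thesis using AB zero' pq that by (auto simp: \<rho>_def \<rho>'_def)
      next
        case False
        then have "real n + real m > 0" by auto
        then have "\<rho> p q > 0"
          using nn[OF AB(1) base] nn[OF AB(2) base] False pq that by (auto simp: \<rho>_def \<rho>'_def)
        then show ?thesis using False pq by auto
      qed
    qed
    show "\<rho> p r \<le> \<rho> p q + \<rho> q r"
      if "p \<in> box_space G \<sigma>" "q \<in> box_space G \<sigma>" "r \<in> box_space G \<sigma>" for p q r
    proof -
      obtain i A j B k C where pqr: "p = (i, A)" "q = (j, B)" "r = (k, C)"
        by (metis surj_pair)
      have m: "A \<in> ?L i" "B \<in> ?L j" "C \<in> ?L k" using that pqr X by auto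
      note n = nn[OF m(1) base] nn[OF m(2) base] nn[OF m(3) base]
      have "\<rho>' p r \<le> \<rho>' p q + \<rho>' q r"
      proof (cases "i = j")
        case True
        then show ?thesis
          using tri[of A i B C] tri[of A i B "\<sigma> i"] base[of i] m pqr n
          by (auto simp: \<rho>'_def)
      next
        case ij: False
        show ?thesis
        proof (cases "j = k")
          case True
          then show ?thesis
            using ij tri[of C k B "\<sigma> k"] base[of k] m pqr n sym[of B C]
            by (auto simp: \<rho>'_def)
        next
          case False
          then show ?thesis
            using ij tri[of A i "\<sigma> i" C] base[of i] m pqr n sym[of C "\<sigma> i"]
            by (auto simp: \<rho>'_def)
        qed
      qed
      then show ?thesis using that by (simp add: \<rho>_def)
    qed
  qed
  moreover have "\<rho> (n, A) (n, B) = set_dist d A B" if "A \<in> ?L n" "B \<in> ?L n" for n A B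
    using that by (simp add: \<rho>_def \<rho>'_def X)
  moreover have "\<exists>N. \<forall>n m. n \<noteq> m \<longrightarrow> n + m \<ge> N \<longrightarrow>
      set_dist \<rho> ({n} \<times> ?L n) ({m} \<times> ?L m) \<ge> C" for C
  proof -
    obtain N :: nat where N: "C \<le> real N" using real_arch_simple by blast
    have "set_dist \<rho> ({n} \<times> ?L n) ({m} \<times> ?L m) \<ge> C" if nm: "n \<noteq> m" "n + m \<ge> N" for n m
      unfolding set_dist_def[of \<rho>]
    proof (rule cINF_greatest)
      show "({n} \<times> ?L n) \<times> ({m} \<times> ?L m) \<noteq> {}" using base by blast
      fix z assume "z \<in> ({n} \<times> ?L n) \<times> ({m} \<times> ?L m)"
      then obtain A B where z: "z = ((n, A), (m, B))" and AB: "A \<in> ?L n" "B \<in> ?L m" by auto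
      have "C \<le> real n + real m" using N nm by linarith
      then show "C \<le> (case z of (p, q) \<Rightarrow> \<rho> p q)"
        using nn[OF AB(1) base] nn[OF AB(2) base] AB nm by (auto simp: z \<rho>_def \<rho>'_def X)
    qed
    then show ?thesis by blast
  qed
  ultimately show ?thesis unfolding box_metric_def by blast
qed


section \<open>The three conditions\<close>

definition box_space_condition ::
    "('a, 'b) monoid_scheme \<Rightarrow> (nat \<Rightarrow> 'a set) \<Rightarrow>
      (nat \<times> 'a set \<Rightarrow> nat \<times> 'a set \<Rightarrow> real) \<Rightarrow> nat \<Rightarrow> bool" where
  "box_space_condition G \<sigma> \<rho> s \<longleftrightarrow>
     semi_conjugacy_separating G \<sigma> \<and> asdim (box_space G \<sigma>) \<rho> \<le> enat s"

text \<open>The last conjunct makes explicit that \<open>U\<close> and \<open>Uh\<close> count as different members of the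
  \<open>\<sigma> n\<close>-invariant family when \<open>h \<noteq> 1\<close>, so that they are disjoint. If \<open>Uh = U\<close> were allowed,
  which can only happen for \<open>h\<close> of finite order, then for a nontrivial finite \<open>G\<close> and the constant
  sequence \<open>\<sigma> n = G\<close> the one-member cover \<open>{G}\<close> would satisfy this condition, although \<open>\<sigma>\<close> is
  not semi-conjugacy-separating.\<close>

definition invariant_cover_condition ::
    "('a, 'b) monoid_scheme \<Rightarrow> ('a \<Rightarrow> 'a \<Rightarrow> real) \<Rightarrow> (nat \<Rightarrow> 'a set) \<Rightarrow> nat \<Rightarrow> bool" where
  "invariant_cover_condition G d \<sigma> s \<longleftrightarrow>
     (\<forall>R>0. \<exists>n \<U>.
        cover_of (carrier G) (\<Union>l\<le>s. \<U> l) \<and>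
        uniformly_bounded d (\<Union>l\<le>s. \<U> l) \<and>
        lebesgue_number_at_least (carrier G) d (\<Union>l\<le>s. \<U> l) R \<and>
        (\<forall>l\<le>s. right_invariant_family G (\<sigma> n) (\<U> l) \<and> disjoint (\<U> l) \<and>
           (\<forall>U\<in>\<U> l. \<forall>h\<in>\<sigma> n - {\<one>\<^bsub>G\<^esub>}. U \<inter> (U #>\<^bsub>G\<^esub> h) = {})))"

definition supp_on :: "'a set \<Rightarrow> ('a \<Rightarrow> real) \<Rightarrow> 'a set" where
  "supp_on X f = {x \<in> X. f x \<noteq> 0}"

definition decay_function_condition ::
    "('a, 'b) monoid_scheme \<Rightarrow> (nat \<Rightarrow> 'a set) \<Rightarrow> nat \<Rightarrow> bool" where
  "decay_function_condition G \<sigma> s \<longleftrightarrow>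
     (\<forall>\<epsilon>>0. \<forall>M. finite M \<longrightarrow> M \<subseteq> carrier G \<longrightarrow>
        (\<exists>n. \<exists>\<mu> :: nat \<Rightarrow> 'a \<Rightarrow> real.
           (\<forall>l\<le>s. \<mu> l \<in> carrier G \<rightarrow> {0..1} \<and> finite (supp_on (carrier G) (\<mu> l))) \<and>
           (\<forall>l\<le>s. \<forall>h\<in>\<sigma> n - {\<one>\<^bsub>G\<^esub>}.
              supp_on (carrier G) (\<mu> l) \<inter> (supp_on (carrier G) (\<mu> l) #>\<^bsub>G\<^esub> h) = {}) \<and>
           (\<forall>g\<in>carrier G. (\<Sum>l\<le>s. \<Sum>\<^sub>\<infinity>h\<in>\<sigma> n. \<mu> l (g \<otimes>\<^bsub>G\<^esub> h)) = 1) \<and>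
           (\<forall>l\<le>s. \<forall>g\<in>M. (SUP x\<in>carrier G. \<bar>\<mu> l x - \<mu> l (g \<otimes>\<^bsub>G\<^esub> x)\<bar>) \<le> \<epsilon>)))"

end

theory Submission
  imports Defs
begin

text \<open>All three conditions are equivalent to a metric-free one: for every finite \<open>M \<subseteq> G\<close> there are
  \<open>n\<close> and finite sets \<open>T\<^sub>0, \<dots>, T\<^sub>s\<close>, each with pairwise disjoint \<open>G\<^sub>n\<close>-translates, such that every
  \<open>Mx\<close> has a \<open>G\<^sub>n\<close>-translate inside some \<open>T\<^sub>l\<close>. The translates of the \<open>T\<^sub>l\<close> form an invariant cover;
  conversely one takes for \<open>T\<^sub>l\<close> the union of one member from each orbit of \<open>\<U>\<^sup>(\<^sup>l\<^sup>)\<close>. The supports of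
  the functions \<open>\<mu>\<^sup>(\<^sup>l\<^sup>)\<close> are such sets, and conversely the truncated distances to the complements of
  the \<open>T\<^sub>l\<close>, normalised to a partition of unity, are such functions. Finally the \<open>T\<^sub>l\<close> project to
  the fibres of the box space, and semi-conjugacy-separation makes \<open>d(x, xh)\<close> uniformly large for
  \<open>1 \<noteq> h \<in> G\<^sub>n\<close>, so that bounded subsets of a fibre lift to \<open>G\<close>.\<close>

\<comment> \<open>\<open><#\<close> is also the strict multiset order, which makes left cosets ambiguous to parse.\<close>
no_notation (input) subset_mset (infix "<#" 50)

section \<open>Diameters, covers and asymptotic dimension\<close>

lemma diam_leI:
  assumes "\<And>x y. x \<in> S \<Longrightarrow> y \<in> S \<Longrightarrow> d x y \<le> D"
  shows "diam d S \<le> ennreal D"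
  unfolding diam_def using assms by (auto intro!: SUP_least ennreal_leI)

lemma dist_le_diam: "x \<in> S \<Longrightarrow> y \<in> S \<Longrightarrow> ennreal (d x y) \<le> diam d S"
  unfolding diam_def by (rule SUP_upper2[of "(x, y)"]) auto

lemma diam_lessD:
  assumes "diam d S < ennreal R" "x \<in> S" "y \<in> S"
  shows "d x y < R"
proof (rule ccontr)
  assume "\<not> d x y < R"
  then have "ennreal R \<le> ennreal (d x y)" by (intro ennreal_leI) simp
  then show False using dist_le_diam[OF assms(2,3), of d] assms(1) by (meson leD le_less_trans)
qed

lemma uniformly_bounded_iff:
  "uniformly_bounded d \<U> \<longleftrightarrow> (\<exists>D\<ge>0. \<forall>U\<in>\<U>. \<forall>x\<in>U. \<forall>y\<in>U. d x y \<le> D)"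
proof
  assume "uniformly_bounded d \<U>"
  then obtain D where D: "\<And>U. U \<in> \<U> \<Longrightarrow> diam d U \<le> ennreal D"
    by (auto simp: uniformly_bounded_def)
  \<comment> \<open>The bound \<open>D\<close> may be negative, in which case
    \<open>ennreal D\<close> is 0.\<close>
  have "d x y \<le> max 0 D" if "U \<in> \<U>" "x \<in> U" "y \<in> U" for U x y
    using order_trans[OF dist_le_diam[OF that(2,3), of d] D[OF that(1)]]
    by (auto simp: ennreal_le_iff2)
  then show "\<exists>D\<ge>0. \<forall>U\<in>\<U>. \<forall>x\<in>U. \<forall>y\<in>U. d x y \<le> D"
    by (intro exI[of _ "max 0 D"]) auto
next
  assume "\<exists>D\<ge>0. \<forall>U\<in>\<U>. \<forall>x\<in>U. \<forall>y\<in>U. d x y \<le> D"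
  then obtain D where "\<And>U x y. U \<in> \<U> \<Longrightarrow> x \<in> U \<Longrightarrow> y \<in> U \<Longrightarrow> d x y \<le> D" by blast
  then have "diam d U \<le> ennreal D" if "U \<in> \<U>" for U
    using that by (intro diam_leI) auto
  then show "uniformly_bounded d \<U>" by (auto simp: uniformly_bounded_def)
qed

lemma lebesgue_number_at_leastI:
  assumes "\<And>S. S \<subseteq> X \<Longrightarrow> (\<And>x y. x \<in> S \<Longrightarrow> y \<in> S \<Longrightarrow> d x y < R) \<Longrightarrow> \<exists>U\<in>\<U>. S \<subseteq> U"
  shows "lebesgue_number_at_least X d \<U> R"
  unfolding lebesgue_number_at_least_def using assms diam_lessD by metis

text \<open>A supremum of distances below \<open>R\<close> may equal \<open>R\<close>, so a uniform
  bound \<open>c\<close> strictly below \<open>R\<close> is needed to make the diameter strictly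
  smaller.\<close>

lemma lebesgue_number_at_leastD:
  assumes "lebesgue_number_at_least X d \<U> R" "S \<subseteq> X" "\<And>x y. x \<in> S \<Longrightarrow> y \<in> S \<Longrightarrow> d x y \<le> c"
    and "0 \<le> c" "c < R"
  shows "\<exists>U\<in>\<U>. S \<subseteq> U"
proof -
  have "diam d S \<le> ennreal c" using assms(3) by (rule diam_leI)
  also have "\<dots> < ennreal R" using assms by (simp add: ennreal_less_iff)
  finally show ?thesis using assms(1,2) by (simp add: lebesgue_number_at_least_def)
qed

lemma finite_dist_bounded:
  fixes d :: "'a \<Rightarrow> 'a \<Rightarrow> real"
  assumes "finite T"
  shows "\<exists>D\<ge>0. \<forall>x\<in>T. \<forall>y\<in>T. d x y \<le> D"
proof -
  have "finite (insert 0 (case_prod d ` (T \<times> T)))" using assms by simp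
  then obtain D where "\<forall>z\<in>insert 0 (case_prod d ` (T \<times> T)). z \<le> D"
    by (meson Max_ge)
  then show ?thesis by (intro exI[of _ D]) auto
qed

text \<open>The infimum of a nonempty subset of \<open>enat\<close> is attained, and families up to
  \<open>t\<close> become families up to any larger \<open>s\<close> by adding empty ones.\<close>

lemma asdim_le_iff:
  "asdim X d \<le> enat s \<longleftrightarrow> (\<forall>R>0. \<exists>\<V>.
     cover_of X (\<Union>l\<le>s. \<V> l) \<and> uniformly_bounded d (\<Union>l\<le>s. \<V> l) \<and>
     lebesgue_number_at_least X d (\<Union>l\<le>s. \<V> l) R \<and> (\<forall>l\<le>s. disjoint (\<V> l)))"
  (is "_ \<longleftrightarrow> ?P s")
proof -
  define A where "A = {enat s | s. ?P s}"
  have asdim: "asdim X d = Inf A" by (simp add: A_def asdim_def)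
  show ?thesis
  proof
    assume le: "asdim X d \<le> enat s"
    then have "A \<noteq> {}" using asdim by (auto simp: Inf_enat_def)
    then have "Inf A \<in> A" by (metis Inf_enat_def LeastI ex_in_conv)
    then obtain t where t: "t \<le> s" "?P t" using le asdim by (auto simp: A_def)
    show "?P s"
    proof (intro allI impI)
      fix R :: real assume "R > 0"
      then obtain \<V> where V: "cover_of X (\<Union>l\<le>t. \<V> l)" "uniformly_bounded d (\<Union>l\<le>t. \<V> l)"
        "lebesgue_number_at_least X d (\<Union>l\<le>t. \<V> l) R" "\<forall>l\<le>t. disjoint (\<V> l)"
        using t(2) by blast
      let ?W = "\<lambda>l. if l \<le> t then \<V> l else {}"
      have "{..s} \<inter> {l. l \<le> t} = {..t}" using t(1) by auto
      then have "(\<Union>l\<le>s. ?W l) = (\<Union>l\<le>t. \<V> l)" by (auto split: if_splits)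
      then show "\<exists>\<V>. cover_of X (\<Union>l\<le>s. \<V> l) \<and> uniformly_bounded d (\<Union>l\<le>s. \<V> l) \<and>
          lebesgue_number_at_least X d (\<Union>l\<le>s. \<V> l) R \<and> (\<forall>l\<le>s. disjoint (\<V> l))"
        using V by (intro exI[of _ ?W]) auto
    qed
  next
    assume "?P s"
    then have "enat s \<in> A" by (auto simp: A_def)
    then show "asdim X d \<le> enat s" unfolding asdim by (rule Inf_lower)
  qed
qed


section \<open>Towers of translates\<close>

text \<open>For a subgroup \<open>H\<close> and \<open>T\<close> inside the group this says that
  \<open>T\<close> meets every left coset of \<open>H\<close> in at most one point, so that
  projection to the coset space is injective on \<open>T\<close>.\<close>

definition free_translates :: "('a, 'b) monoid_scheme \<Rightarrow> 'a set \<Rightarrow> 'a set \<Rightarrow> bool" where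
  "free_translates G H T \<longleftrightarrow> (\<forall>x\<in>T. \<forall>h\<in>H. x \<otimes>\<^bsub>G\<^esub> h \<in> T \<longrightarrow> h = \<one>\<^bsub>G\<^esub>)"

lemma free_translates_iff:
  "free_translates G H T \<longleftrightarrow> (\<forall>h\<in>H - {\<one>\<^bsub>G\<^esub>}. T \<inter> (T #>\<^bsub>G\<^esub> h) = {})"
  by (auto simp: free_translates_def r_coset_def)

text \<open>Under a right-invariant metric \<open>Mx\<close> is the ball about \<open>x\<close> when
  \<open>M\<close> is the ball of the same radius about the identity. Finite sets \<open>M\<close>
  thus take over the role of Lebesgue numbers, and no metric has to be chosen.\<close>

definition tower_condition :: "('a, 'b) monoid_scheme \<Rightarrow> (nat \<Rightarrow> 'a set) \<Rightarrow> nat \<Rightarrow> bool" where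
  "tower_condition G \<sigma> s \<longleftrightarrow>
     (\<forall>M. finite M \<longrightarrow> M \<subseteq> carrier G \<longrightarrow> (\<exists>n T.
        (\<forall>l\<le>s. T l \<subseteq> carrier G \<and> finite (T l) \<and> free_translates G (\<sigma> n) (T l)) \<and>
        (\<forall>x\<in>carrier G. \<exists>l\<le>s. \<exists>h\<in>\<sigma> n. \<forall>g\<in>M. g \<otimes>\<^bsub>G\<^esub> x \<otimes>\<^bsub>G\<^esub> h \<in> T l)))"

lemma tower_conditionD:
  assumes "tower_condition G \<sigma> s" "finite M" "M \<subseteq> carrier G"
  obtains n T where
    "\<And>l. l \<le> s \<Longrightarrow> T l \<subseteq> carrier G" "\<And>l. l \<le> s \<Longrightarrow> finite (T l)"
    "\<And>l. l \<le> s \<Longrightarrow> free_translates G (\<sigma> n) (T l)"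
    "\<And>x. x \<in> carrier G \<Longrightarrow> \<exists>l\<le>s. \<exists>h\<in>\<sigma> n. \<forall>g\<in>M. g \<otimes>\<^bsub>G\<^esub> x \<otimes>\<^bsub>G\<^esub> h \<in> T l"
proof -
  obtain n T where
    "\<forall>l\<le>s. T l \<subseteq> carrier G \<and> finite (T l) \<and> free_translates G (\<sigma> n) (T l)"
    "\<forall>x\<in>carrier G. \<exists>l\<le>s. \<exists>h\<in>\<sigma> n. \<forall>g\<in>M. g \<otimes>\<^bsub>G\<^esub> x \<otimes>\<^bsub>G\<^esub> h \<in> T l"
    using assms(1)[unfolded tower_condition_def, rule_format, OF assms(2,3)] by (elim exE conjE)
  then show thesis by (intro that[of T n]) simp_all
qed

section \<open>Left cosets of a subgroup\<close>

context group
begin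

lemma lcoset_in_lcosets: "x \<in> carrier G \<Longrightarrow> x <# H \<in> lcosets H"
  by (auto simp: LCOSETS_def)

lemma lcosets_mem:
  assumes "subgroup H G" "A \<in> lcosets H" "a \<in> A"
  shows "a \<in> carrier G" "A = a <# H"
proof -
  obtain x where x: "x \<in> carrier G" "A = x <# H" using assms by (auto simp: LCOSETS_def)
  show "a \<in> carrier G" using assms subgroup.lcosets_carrier[OF assms(1) is_group] by blast
  show "A = a <# H" using x assms l_repr_independence by metis
qed

lemma lcosets_nonempty:
  assumes "subgroup H G" "A \<in> lcosets H"
  shows "\<exists>a\<in>carrier G. A = a <# H"
  using assms by (auto simp: LCOSETS_def)

lemma lcoset_eq_iff:
  assumes "subgroup H G" "x \<in> carrier G" "y \<in> carrier G"
  shows "x <# H = y <# H \<longleftrightarrow> (\<exists>h\<in>H. y = x \<otimes> h)"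
proof
  assume "x <# H = y <# H"
  then have "y \<in> x <# H" using assms lcos_self by metis
  then show "\<exists>h\<in>H. y = x \<otimes> h" by (auto simp: l_coset_def)
next
  assume "\<exists>h\<in>H. y = x \<otimes> h"
  then have "y \<in> x <# H" by (auto simp: l_coset_def)
  then show "x <# H = y <# H" using assms l_repr_independence by metis
qed

lemma lcoset_mult_right:
  assumes "subgroup H G" "x \<in> carrier G" "h \<in> H"
  shows "(x \<otimes> h) <# H = x <# H"
  using assms lcoset_eq_iff[of H x "x \<otimes> h"] subgroup.mem_carrier by fastforce

end

section \<open>Proper right-invariant metrics\<close>

locale proper_metric_group = group G for G (structure) +
  fixes d :: "'a \<Rightarrow> 'a \<Rightarrow> real"
  assumes proper_metric: "proper_right_invariant_metric G d"
begin

sublocale Metric_space "carrier G" d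
  using proper_metric by (simp add: proper_right_invariant_metric_def)

lemma finite_mball: "x \<in> carrier G \<Longrightarrow> finite (mball x r)"
  using proper_metric by (simp add: proper_right_invariant_metric_def)

lemma dist_mult_right:
  "x \<in> carrier G \<Longrightarrow> y \<in> carrier G \<Longrightarrow> g \<in> carrier G \<Longrightarrow> d (x \<otimes> g) (y \<otimes> g) = d x y"
  using proper_metric by (simp add: proper_right_invariant_metric_def)

lemma dist_mult_left:
  "x \<in> carrier G \<Longrightarrow> g \<in> carrier G \<Longrightarrow> d x (g \<otimes> x) = d \<one> g"
  using dist_mult_right[of \<one> g x] by simp

lemma dist_eq_quotient:
  "x \<in> carrier G \<Longrightarrow> y \<in> carrier G \<Longrightarrow> d x y = d \<one> (y \<otimes> inv x)"
  using dist_mult_left[of x "y \<otimes> inv x"] by (simp add: m_assoc)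

lemma finite_subset_mball_one:
  assumes "finite M" "M \<subseteq> carrier G"
  obtains R where "R > 0" "\<And>g. g \<in> M \<Longrightarrow> d \<one> g < R"
proof -
  obtain D where D: "0 \<le> D" "\<forall>x\<in>insert \<one> M. \<forall>y\<in>insert \<one> M. d x y \<le> D"
    using finite_dist_bounded[of "insert \<one> M" d] assms(1) by auto
  have "d \<one> g < D + 1" if "g \<in> M" for g
  proof -
    have "d \<one> g \<le> D" using D(2) that by blast
    then show ?thesis by simp
  qed
  then show thesis using that[of "D + 1"] D(1) by auto
qed

lemma finite_if_dist_bounded:
  assumes "U \<subseteq> carrier G" "\<And>x y. x \<in> U \<Longrightarrow> y \<in> U \<Longrightarrow> d x y \<le> D"
  shows "finite U"
proof (cases "U = {}")
  case False
  then obtain x where x: "x \<in> U" by blast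
  have "U \<subseteq> mball x (D + 1)"
  proof
    fix y assume y: "y \<in> U"
    have "d x y \<le> D" using assms x y by blast
    then show "y \<in> mball x (D + 1)" using assms(1) x y by auto
  qed
  then show ?thesis using finite_mball assms(1) x finite_subset by blast
qed simp


section \<open>Invariant covers\<close>

text \<open>The members are the translates of the \<open>T l\<close>. Right-invariance bounds them
  uniformly, since each \<open>T l\<close> is finite; freeness makes them disjoint; and the tower
  for the ball of radius \<open>R\<close> puts each set with pairwise distances below
  \<open>R\<close> inside one translate.\<close>

lemma invariant_cover_if_tower:
  assumes H: "\<And>n. subgroup (\<sigma> n) G" and tower: "tower_condition G \<sigma> s"
  shows "invariant_cover_condition G d \<sigma> s"
  unfolding invariant_cover_condition_def
proof (intro allI impI)
  fix R :: real assume R: "R > 0"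
  obtain n T where T: "\<And>l. l \<le> s \<Longrightarrow> T l \<subseteq> carrier G" "\<And>l. l \<le> s \<Longrightarrow> finite (T l)"
    "\<And>l. l \<le> s \<Longrightarrow> free_translates G (\<sigma> n) (T l)"
    "\<And>x. x \<in> carrier G \<Longrightarrow> \<exists>l\<le>s. \<exists>h\<in>\<sigma> n. \<forall>g\<in>mball \<one> R. g \<otimes> x \<otimes> h \<in> T l"
    by (rule tower_conditionD[OF tower finite_mball[OF one_closed, of R] mball_subset_mspace])
      (rule that)
  interpret H: subgroup "\<sigma> n" G by (rule H)
  define \<U> where "\<U> = (\<lambda>l. (\<lambda>h. T l #> h) ` \<sigma> n)"
  have sub: "U \<subseteq> carrier G" if "l \<le> s" "U \<in> \<U> l" for l U
    using that T(1)[of l] by (auto simp: \<U>_def r_coset_def)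
  have leb: "\<exists>U\<in>\<Union>l\<le>s. \<U> l. S \<subseteq> U"
    if S: "S \<subseteq> carrier G" "\<And>x y. x \<in> S \<Longrightarrow> y \<in> S \<Longrightarrow> d x y < R" for S
  proof (cases "S = {}")
    case True
    have "T 0 #> \<one> \<in> \<U> 0" by (auto simp: \<U>_def)
    then show ?thesis using True by auto
  next
    case False
    then obtain x where x: "x \<in> S" by blast
    then have xG: "x \<in> carrier G" using S by blast
    obtain l h where lh: "l \<le> s" "h \<in> \<sigma> n" "\<forall>g\<in>mball \<one> R. g \<otimes> x \<otimes> h \<in> T l"
      using T(4)[OF xG] by blast
    have "y \<in> T l #> inv h" if y: "y \<in> S" for y
    proof -
      have yG: "y \<in> carrier G" using y S by blast
      \<comment> \<open>The quotient \<open>y \<otimes> inv x\<close> plays the role of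
        \<open>g\<close>: it carries \<open>x\<close> to \<open>y\<close>.\<close>
      have "d \<one> (y \<otimes> inv x) < R" using dist_eq_quotient[OF xG yG] S(2)[OF x y] by simp
      then have "y \<otimes> inv x \<otimes> x \<otimes> h \<in> T l" using lh(3) xG yG by simp
      then have "y \<otimes> h \<in> T l" using xG yG by (simp add: m_assoc)
      moreover have "y = y \<otimes> h \<otimes> inv h" using yG lh(2) by (simp add: m_assoc)
      ultimately show ?thesis unfolding r_coset_def by blast
    qed
    then show ?thesis using lh(1,2) by (intro bexI[of _ "T l #> inv h"]) (auto simp: \<U>_def)
  qed
  have "cover_of (carrier G) (\<Union>l\<le>s. \<U> l)"
    unfolding cover_of_def
  proof
    show "\<Union> (\<Union>l\<le>s. \<U> l) \<subseteq> carrier G" using sub by blast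
    show "carrier G \<subseteq> \<Union> (\<Union>l\<le>s. \<U> l)"
    proof
      fix x assume "x \<in> carrier G"
      then have "\<exists>U\<in>\<Union>l\<le>s. \<U> l. {x} \<subseteq> U" using R by (intro leb) auto
      then show "x \<in> \<Union> (\<Union>l\<le>s. \<U> l)" by blast
    qed
  qed
  moreover have "uniformly_bounded d (\<Union>l\<le>s. \<U> l)"
  proof -
    have "finite (\<Union>l\<le>s. T l)" using T(2) by auto
    then obtain D where D: "D \<ge> 0" "\<forall>x\<in>\<Union>l\<le>s. T l. \<forall>y\<in>\<Union>l\<le>s. T l. d x y \<le> D"
      using finite_dist_bounded by blast
    have "d x y \<le> D" if l: "l \<le> s" "U \<in> \<U> l" "x \<in> U" "y \<in> U" for l U x y
    proof -
      obtain h a b where "h \<in> \<sigma> n" "a \<in> T l" "b \<in> T l" "x = a \<otimes> h" "y = b \<otimes> h"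
        using l by (auto simp: \<U>_def r_coset_def)
      moreover from this have "d x y = d a b" using T(1)[OF l(1)] by (auto intro!: dist_mult_right)
      ultimately show ?thesis using D(2) l(1) by auto
    qed
    then show ?thesis unfolding uniformly_bounded_iff using D(1) by blast
  qed
  moreover have "lebesgue_number_at_least (carrier G) d (\<Union>l\<le>s. \<U> l) R"
    using leb by (rule lebesgue_number_at_leastI)
  moreover have "right_invariant_family G (\<sigma> n) (\<U> l)" if "l \<le> s" for l
    using T(1)[OF that] by (auto simp: right_invariant_family_def \<U>_def coset_mult_assoc)
  moreover have "disjoint (\<U> l)" if l: "l \<le> s" for l
  proof -
    have "h = k" if hk: "h \<in> \<sigma> n" "k \<in> \<sigma> n" and z: "z \<in> T l #> h" "z \<in> T l #> k" for h k z
    proof -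
      obtain a b where ab: "a \<in> T l" "b \<in> T l" "z = a \<otimes> h" "z = b \<otimes> k"
        using z by (auto simp: r_coset_def)
      have G: "a \<in> carrier G" "b \<in> carrier G" using ab T(1)[OF l] by auto
      have "a = z \<otimes> inv h" using ab(3) hk G by (simp add: m_assoc)
      then have "a = b \<otimes> (k \<otimes> inv h)" using ab(4) hk G by (simp add: m_assoc)
      then have "k \<otimes> inv h = \<one>" using T(3)[OF l] ab hk unfolding free_translates_def by auto
      then show ?thesis using hk inv_solve_right'[of \<one> k h] by simp
    qed
    then show ?thesis unfolding \<U>_def disjoint_def by blast
  qed
  moreover have "U \<inter> (U #> h) = {}" if l: "l \<le> s" "U \<in> \<U> l" "h \<in> \<sigma> n - {\<one>}" for l U h
  proof -
    obtain k where k: "k \<in> \<sigma> n" "U = T l #> k" using l by (auto simp: \<U>_def)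
    show ?thesis
    proof (rule ccontr)
      assume "U \<inter> (U #> h) \<noteq> {}"
      then obtain a b where ab: "a \<in> T l" "b \<in> T l" "a \<otimes> k = b \<otimes> k \<otimes> h"
        using k by (auto simp: r_coset_def)
      have G: "a \<in> carrier G" "b \<in> carrier G" using ab T(1)[OF l(1)] by auto
      have "a = a \<otimes> k \<otimes> inv k" using k G by (simp add: m_assoc)
      \<comment> \<open>\<open>\<sigma> n\<close> need not be normal, but the conjugating element
        \<open>k\<close> lies in it, so the conjugate of \<open>h\<close> stays in
        \<open>\<sigma> n\<close> and freeness applies.\<close>
      then have "a = b \<otimes> (k \<otimes> h \<otimes> inv k)" unfolding ab(3) using k l(3) G by (simp add: m_assoc)
      then have "k \<otimes> h \<otimes> inv k = \<one>"
        using T(3)[OF l(1)] ab k l(3) unfolding free_translates_def by auto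
      then have "k \<otimes> h = k" using k l(3) inv_solve_right'[of \<one> "k \<otimes> h" k] by simp
      then show False using k l(3) by auto
    qed
  qed
  ultimately show "\<exists>n \<U>. cover_of (carrier G) (\<Union>l\<le>s. \<U> l) \<and>
        uniformly_bounded d (\<Union>l\<le>s. \<U> l) \<and>
        lebesgue_number_at_least (carrier G) d (\<Union>l\<le>s. \<U> l) R \<and>
        (\<forall>l\<le>s. right_invariant_family G (\<sigma> n) (\<U> l) \<and> disjoint (\<U> l) \<and>
           (\<forall>U\<in>\<U> l. \<forall>h\<in>\<sigma> n - {\<one>}. U \<inter> (U #> h) = {}))"
    by (intro exI[of _ n] exI[of _ \<U>]) simp
qed

text \<open>Two members of \<open>\<U> l\<close> lie in one orbit exactly when they have the same
  image in the coset space: a common coset makes a translate of one meet the other, hence equal it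
  by disjointness. Finite index leaves finitely many images and properness makes each member finite,
  so one member per image gives a finite \<open>T l\<close>.\<close>

lemma tower_if_invariant_cover:
  assumes H: "\<And>n. finite_index_subgroup G (\<sigma> n)" and cover: "invariant_cover_condition G d \<sigma> s"
  shows "tower_condition G \<sigma> s"
  unfolding tower_condition_def
proof (intro allI impI)
  fix M assume M: "finite M" "M \<subseteq> carrier G"
  obtain R where R: "R > 0" "\<And>g. g \<in> M \<Longrightarrow> d \<one> g < R"
    using finite_subset_mball_one[OF M] by blast
  \<comment> \<open>The points of \<open>Mx\<close> together with \<open>x\<close> have pairwise
    distances at most \<open>2 * R\<close>, which has to lie strictly below the Lebesgue
    number.\<close>
  have "3 * R > 0" using R by simp
  then obtain n \<U> where cov: "cover_of (carrier G) (\<Union>l\<le>s. \<U> l)"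
    and bdd: "uniformly_bounded d (\<Union>l\<le>s. \<U> l)"
    and leb: "lebesgue_number_at_least (carrier G) d (\<Union>l\<le>s. \<U> l) (3 * R)"
    and fam: "\<forall>l\<le>s. right_invariant_family G (\<sigma> n) (\<U> l) \<and> disjoint (\<U> l) \<and>
        (\<forall>U\<in>\<U> l. \<forall>h\<in>\<sigma> n - {\<one>}. U \<inter> (U #> h) = {})"
    using cover unfolding invariant_cover_condition_def by blast
  have inv: "right_invariant_family G (\<sigma> n) (\<U> l)" and disj: "disjoint (\<U> l)"
    and free: "U \<in> \<U> l \<Longrightarrow> h \<in> \<sigma> n - {\<one>} \<Longrightarrow> U \<inter> (U #> h) = {}"
    if "l \<le> s" for l U h
    using fam that by blast+
  have sub: "U \<subseteq> carrier G" if "l \<le> s" "U \<in> \<U> l" for l U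
    using cov that unfolding cover_of_def by blast
  obtain D where D: "\<And>l U x y. l \<le> s \<Longrightarrow> U \<in> \<U> l \<Longrightarrow> x \<in> U \<Longrightarrow> y \<in> U \<Longrightarrow> d x y \<le> D"
    using bdd unfolding uniformly_bounded_iff by blast
  have sg: "subgroup (\<sigma> n) G" using H by (simp add: finite_index_subgroup_def)
  then interpret H: subgroup "\<sigma> n" G .
  \<comment> \<open>\<open>p\<close> is the invariant that tells orbits apart;
    \<open>inv_into\<close> then chooses one member of each orbit.\<close>
  define p where "p = (\<lambda>U. (\<lambda>x. x <# \<sigma> n) ` U)"
  define T where "T = (\<lambda>l. \<Union>P\<in>p ` \<U> l. inv_into (\<U> l) p P)"
  have meet: "U #> h = W"
    if "l \<le> s" "U \<in> \<U> l" "W \<in> \<U> l" "h \<in> \<sigma> n" "x \<in> U" "x \<otimes> h \<in> W" for l U W h x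
  proof -
    have "U #> h \<in> \<U> l" using inv that by (simp add: right_invariant_family_def)
    moreover have "x \<otimes> h \<in> U #> h" using that by (auto simp: r_coset_def)
    ultimately show ?thesis using disj[of l] that by (auto simp: disjoint_def)
  qed
  have p_translate: "p (U #> h) = p U" if "l \<le> s" "U \<in> \<U> l" "h \<in> \<sigma> n" for l U h
  proof -
    have "p (U #> h) = (\<lambda>x. (x \<otimes> h) <# \<sigma> n) ` U" by (auto simp: p_def r_coset_def)
    also have "\<dots> = p U"
      unfolding p_def using that sub by (intro image_cong) (auto intro!: lcoset_mult_right[OF sg])
    finally show ?thesis .
  qed
  have "T l \<subseteq> carrier G" if l: "l \<le> s" for l
  proof -
    have "inv_into (\<U> l) p P \<subseteq> carrier G" if "P \<in> p ` \<U> l" for P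
      using sub[OF l inv_into_into[OF that]] .
    then show ?thesis by (auto simp: T_def)
  qed
  moreover have "finite (T l)" if l: "l \<le> s" for l
  proof -
    have "p ` \<U> l \<subseteq> Pow (lcosets (\<sigma> n))"
      using sub[OF l] by (auto simp: p_def intro!: lcoset_in_lcosets)
    moreover have "finite (Pow (lcosets (\<sigma> n)))" using H by (simp add: finite_index_subgroup_def)
    ultimately have "finite (p ` \<U> l)" by (rule finite_subset)
    moreover have "finite (inv_into (\<U> l) p P)" if "P \<in> p ` \<U> l" for P
      using finite_if_dist_bounded[of _ D, OF sub[OF l inv_into_into[OF that]]]
        D[OF l inv_into_into[OF that]] by blast
    ultimately show ?thesis unfolding T_def by (rule finite_UN_I)
  qed
  moreover have "free_translates G (\<sigma> n) (T l)" if l: "l \<le> s" for l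
    unfolding free_translates_def
  proof (intro ballI impI)
    fix x h assume x: "x \<in> T l" and h: "h \<in> \<sigma> n" and xh: "x \<otimes> h \<in> T l"
    obtain P where P: "P \<in> p ` \<U> l" "x \<in> inv_into (\<U> l) p P" using x by (auto simp: T_def)
    obtain Q where Q: "Q \<in> p ` \<U> l" "x \<otimes> h \<in> inv_into (\<U> l) p Q" using xh by (auto simp: T_def)
    have "inv_into (\<U> l) p P #> h = inv_into (\<U> l) p Q"
      using meet[OF l inv_into_into[OF P(1)] inv_into_into[OF Q(1)] h P(2) Q(2)] .
    \<comment> \<open>Translates have the same image under \<open>p\<close>, so both representatives
      are the one chosen for that image.\<close>
    then have "P = Q"
      using p_translate[OF l inv_into_into[OF P(1)] h] f_inv_into_f[OF P(1)] f_inv_into_f[OF Q(1)]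
      by simp
    moreover have "x \<otimes> h \<in> inv_into (\<U> l) p P #> h" using P(2) by (auto simp: r_coset_def)
    ultimately show "h = \<one>" using free[OF l inv_into_into[OF P(1)], of h] h Q(2) by blast
  qed
  moreover have "\<exists>l\<le>s. \<exists>h\<in>\<sigma> n. \<forall>g\<in>M. g \<otimes> x \<otimes> h \<in> T l" if x: "x \<in> carrier G" for x
  proof -
    \<comment> \<open>\<open>M\<close> may lack the identity; \<open>x\<close> itself must lie in
      the member because its coset locates the required translate.\<close>
    let ?S = "insert x ((\<lambda>g. g \<otimes> x) ` M)"
    have S: "?S \<subseteq> carrier G" using x M by auto
    have near: "d x y \<le> R" if y: "y \<in> ?S" for y
    proof (cases "y = x")
      case False
      then obtain g where g: "g \<in> M" "y = g \<otimes> x" using y by auto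
      have "g \<in> carrier G" using g(1) M(2) by blast
      then have "d x y = d \<one> g" using dist_mult_left x g(2) by simp
      then show ?thesis using R(2)[OF g(1)] by simp
    qed (use x R(1) in simp)
    have "\<exists>U\<in>\<Union>l\<le>s. \<U> l. ?S \<subseteq> U"
    proof (rule lebesgue_number_at_leastD[OF leb S])
      show "d y z \<le> 2 * R" if yz: "y \<in> ?S" "z \<in> ?S" for y z
      proof -
        have "d y z \<le> d x y + d x z" using triangle[of y x z] commute[of y x] S x yz by auto
        then show ?thesis using near[OF yz(1)] near[OF yz(2)] by linarith
      qed
    qed (use R in auto)
    then obtain l U where U: "l \<le> s" "U \<in> \<U> l" "?S \<subseteq> U" by blast
    let ?W = "inv_into (\<U> l) p (p U)"
    have W: "?W \<in> \<U> l" "p ?W = p U"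
      using inv_into_into[of "p U" p "\<U> l"] f_inv_into_f[of "p U" p "\<U> l"] U(2) by auto
    have "x <# \<sigma> n \<in> p ?W" using W U by (auto simp: p_def)
    then obtain w where w: "w \<in> ?W" "x <# \<sigma> n = w <# \<sigma> n" by (auto simp: p_def)
    then obtain h where h: "h \<in> \<sigma> n" "w = x \<otimes> h"
      using lcoset_eq_iff[OF sg x] sub[OF U(1) W(1)] by blast
    \<comment> \<open>The element \<open>h\<close> was found from \<open>x\<close> alone;
      disjointness makes it move all of \<open>U\<close>, and with it all of \<open>Mx\<close>, into
      the representative.\<close>
    have "U #> h = ?W" using meet[OF U(1,2) W(1) h(1)] w h U by auto
    then have "g \<otimes> x \<otimes> h \<in> ?W" if "g \<in> M" for g
      using that U(3) unfolding r_coset_def by blast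
    moreover have "?W \<subseteq> T l" using U(2) by (auto simp: T_def)
    ultimately show ?thesis using U(1) h(1) by blast
  qed
  ultimately show "\<exists>n T. (\<forall>l\<le>s. T l \<subseteq> carrier G \<and> finite (T l) \<and> free_translates G (\<sigma> n) (T l)) \<and>
        (\<forall>x\<in>carrier G. \<exists>l\<le>s. \<exists>h\<in>\<sigma> n. \<forall>g\<in>M. g \<otimes> x \<otimes> h \<in> T l)"
    by (intro exI[of _ n] exI[of _ T]) simp
qed

end


section \<open>Decay functions\<close>

text \<open>The unique nonzero term, if there is one, is positive and serves as \<open>a\<close>; if
  all terms vanish, any point of the nonempty \<open>A\<close> does. The sum is thereby a maximum,
  which makes orbit sums easy to estimate.\<close>

lemma infsum_at_most_one_nonzero:
  fixes f :: "'b \<Rightarrow> real"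
  assumes "A \<noteq> {}" and nonneg: "\<And>x. x \<in> A \<Longrightarrow> 0 \<le> f x"
    and unique: "\<And>x y. x \<in> A \<Longrightarrow> y \<in> A \<Longrightarrow> f x \<noteq> 0 \<Longrightarrow> f y \<noteq> 0 \<Longrightarrow> x = y"
  obtains a where "a \<in> A" "infsum f A = f a" "\<And>b. b \<in> A \<Longrightarrow> f b \<le> f a"
proof (cases "\<exists>a\<in>A. f a \<noteq> 0")
  case True
  then obtain a where a: "a \<in> A" "f a \<noteq> 0" by blast
  have zero: "f b = 0" if "b \<in> A" "b \<noteq> a" for b
    using unique[OF a(1) that(1) a(2)] that(2) by blast
  have "infsum f A = infsum f {a}"
    using a zero by (intro infsum_cong_neutral) auto
  then show thesis
    using that[OF a(1)] zero nonneg[OF a(1)] by (metis infsum_finite finite.emptyI finite_insert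
      order_refl sum.empty sum.insert add.right_neutral empty_iff)
next
  case False
  then have "infsum f A = 0" by (intro infsum_0) auto
  then show thesis using that False assms(1) by (metis all_not_in_conv order_refl)
qed

text \<open>Freeness lets the coset of \<open>x\<close> meet \<open>T\<close> at most once, so at
  most one term of the sum over it is nonzero.\<close>

lemma (in group) free_translates_infsum:
  fixes f :: "'a \<Rightarrow> real"
  assumes H: "subgroup H G" and T: "free_translates G H T" "T \<subseteq> carrier G"
    and f: "\<And>x. x \<in> carrier G \<Longrightarrow> 0 \<le> f x" "\<And>x. x \<in> carrier G \<Longrightarrow> x \<notin> T \<Longrightarrow> f x = 0"
    and x: "x \<in> carrier G"
  obtains a where "a \<in> H" "(\<Sum>\<^sub>\<infinity>h\<in>H. f (x \<otimes> h)) = f (x \<otimes> a)"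
    "\<And>b. b \<in> H \<Longrightarrow> f (x \<otimes> b) \<le> f (x \<otimes> a)"
proof -
  interpret H: subgroup H G by (rule H)
  show thesis
  proof (rule infsum_at_most_one_nonzero[of H "\<lambda>h. f (x \<otimes> h)"])
    show "H \<noteq> {}" using H.one_closed by blast
    show "0 \<le> f (x \<otimes> h)" if "h \<in> H" for h using that x f(1) by simp
    show "h = k" if hk: "h \<in> H" "k \<in> H" and nz: "f (x \<otimes> h) \<noteq> 0" "f (x \<otimes> k) \<noteq> 0" for h k
    proof -
      have "x \<otimes> h \<in> T" "x \<otimes> k \<in> T" using nz f(2)[of "x \<otimes> h"] f(2)[of "x \<otimes> k"] hk x by auto
      moreover have "x \<otimes> k = x \<otimes> h \<otimes> (inv h \<otimes> k)" using hk x by (simp add: m_assoc inv_solve_left flip: m_assoc) (simp add: m_assoc)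
      ultimately have "inv h \<otimes> k = \<one>" using T(1) hk unfolding free_translates_def by auto
      then show ?thesis using hk inv_solve_left'[of \<one> h k] by simp
    qed
  qed (use that in blast)
qed

text \<open>The supports serve as \<open>T l\<close>. At each \<open>x\<close> one of the
  \<open>s + 1\<close> orbit sums, which is a single value \<open>\<mu> l (x \<otimes> h)\<close>,
  is at least \<open>1 / (s + 1)\<close>. A smaller variation along \<open>M\<close> keeps all of
  \<open>Mxh\<close> in the support.\<close>

lemma (in group) tower_if_decay_functions:
  assumes H: "\<And>n. subgroup (\<sigma> n) G" and decay: "decay_function_condition G \<sigma> s"
  shows "tower_condition G \<sigma> s"
  unfolding tower_condition_def
proof (intro allI impI)
  fix M assume M: "finite M" "M \<subseteq> carrier G"
  \<comment> \<open>Any positive tolerance strictly below \<open>1 / (s + 1)\<close> would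
    do.\<close>
  have pos: "1 / real (s + 2) > 0" by simp
  obtain n and \<mu> :: "nat \<Rightarrow> 'a \<Rightarrow> real" where
    \<mu>: "\<forall>l\<le>s. \<mu> l \<in> carrier G \<rightarrow> {0..1} \<and> finite (supp_on (carrier G) (\<mu> l))"
    and free: "\<forall>l\<le>s. \<forall>h\<in>\<sigma> n - {\<one>}. supp_on (carrier G) (\<mu> l) \<inter> (supp_on (carrier G) (\<mu> l) #> h) = {}"
    and sum: "\<forall>g\<in>carrier G. (\<Sum>l\<le>s. \<Sum>\<^sub>\<infinity>h\<in>\<sigma> n. \<mu> l (g \<otimes> h)) = 1"
    and lip: "\<forall>l\<le>s. \<forall>g\<in>M. (SUP x\<in>carrier G. \<bar>\<mu> l x - \<mu> l (g \<otimes> x)\<bar>) \<le> 1 / real (s + 2)"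
    using decay[unfolded decay_function_condition_def, rule_format, OF pos M] by (elim exE conjE)
  interpret H: subgroup "\<sigma> n" G by (rule H)
  define T where "T = (\<lambda>l. supp_on (carrier G) (\<mu> l))"
  have TG: "T l \<subseteq> carrier G" for l by (auto simp: T_def supp_on_def)
  have T: "free_translates G (\<sigma> n) (T l)" if "l \<le> s" for l
    using free that unfolding free_translates_iff T_def by simp
  have \<mu>01: "0 \<le> \<mu> l x" "\<mu> l x \<le> 1" if "l \<le> s" "x \<in> carrier G" for l x
    using \<mu> that by (auto simp: Pi_iff)
  have "\<exists>l\<le>s. \<exists>h\<in>\<sigma> n. \<forall>g\<in>M. g \<otimes> x \<otimes> h \<in> T l" if x: "x \<in> carrier G" for x
  proof -
    have "\<exists>l\<le>s. 1 / real (s + 1) \<le> (\<Sum>\<^sub>\<infinity>h\<in>\<sigma> n. \<mu> l (x \<otimes> h))"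
    proof (rule ccontr)
      assume "\<not> ?thesis"
      then have "(\<Sum>\<^sub>\<infinity>h\<in>\<sigma> n. \<mu> l (x \<otimes> h)) < 1 / real (s + 1)" if "l \<le> s" for l
        using that not_le by blast
      then have "(\<Sum>l\<le>s. \<Sum>\<^sub>\<infinity>h\<in>\<sigma> n. \<mu> l (x \<otimes> h)) < real (card {..s}) * (1 / real (s + 1))"
        by (intro sum_bounded_above_strict) auto
      then show False using sum x by simp
    qed
    then obtain l where l: "l \<le> s" "1 / real (s + 1) \<le> (\<Sum>\<^sub>\<infinity>h\<in>\<sigma> n. \<mu> l (x \<otimes> h))" by blast
    have out: "\<mu> l y = 0" if "y \<in> carrier G" "y \<notin> T l" for y
      using that by (simp add: T_def supp_on_def)
    obtain h where h: "h \<in> \<sigma> n" "(\<Sum>\<^sub>\<infinity>h\<in>\<sigma> n. \<mu> l (x \<otimes> h)) = \<mu> l (x \<otimes> h)"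
      by (rule free_translates_infsum[where f = "\<mu> l", OF H T[OF l(1)] TG _ _ x])
        (use \<mu>01(1)[OF l(1)] out that in auto)
    have "g \<otimes> x \<otimes> h \<in> T l" if g: "g \<in> M" for g
    proof -
      have gG: "g \<in> carrier G" using g M by blast
      let ?y = "x \<otimes> h"
      have y: "?y \<in> carrier G" using x h by simp
      \<comment> \<open>A real supremum is known to dominate its terms only when they are bounded
        above; the values in [0,1] provide this.\<close>
      have "bdd_above ((\<lambda>x. \<bar>\<mu> l x - \<mu> l (g \<otimes> x)\<bar>) ` carrier G)"
      proof (rule bdd_aboveI2)
        fix z assume z: "z \<in> carrier G"
        show "\<bar>\<mu> l z - \<mu> l (g \<otimes> z)\<bar> \<le> 1"
          using \<mu>01[OF l(1) z] \<mu>01[OF l(1) m_closed[OF gG z]] by linarith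
      qed
      then have "\<bar>\<mu> l ?y - \<mu> l (g \<otimes> ?y)\<bar> \<le> (SUP x\<in>carrier G. \<bar>\<mu> l x - \<mu> l (g \<otimes> x)\<bar>)"
        using y by (intro cSUP_upper)
      also have "\<dots> \<le> 1 / real (s + 2)" using lip l g by blast
      also have "\<dots> < 1 / real (s + 1)" by (simp add: divide_simps)
      finally have "\<mu> l (g \<otimes> ?y) \<noteq> 0" using l(2) h(2) by auto
      then show ?thesis using gG x h by (simp add: T_def supp_on_def m_assoc)
    qed
    then show ?thesis using l(1) h(1) by blast
  qed
  then show "\<exists>n T. (\<forall>l\<le>s. T l \<subseteq> carrier G \<and> finite (T l) \<and> free_translates G (\<sigma> n) (T l)) \<and>
        (\<forall>x\<in>carrier G. \<exists>l\<le>s. \<exists>h\<in>\<sigma> n. \<forall>g\<in>M. g \<otimes> x \<otimes> h \<in> T l)"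
    using T TG \<mu> by (intro exI[of _ n] exI[of _ T]) (simp add: T_def)
qed

text \<open>Split the difference as \<open>(u - v) / p + (v / q) * ((q - p) / p)\<close>, where
  \<open>v / q\<close> lies between 0 and 1. This controls normalisation by a varying denominator
  that is at least \<open>r\<close>.\<close>

lemma abs_diff_quotient_le:
  fixes u v p q :: real
  assumes "0 < r" "r \<le> p" "r \<le> q" "0 \<le> v" "v \<le> q" "\<bar>u - v\<bar> \<le> a" "\<bar>p - q\<bar> \<le> b"
  shows "\<bar>u / p - v / q\<bar> \<le> (a + b) / r"
proof -
  have pq: "p > 0" "q > 0" using assms by auto
  have "u / p - v / q = (u - v) / p + (v / q) * ((q - p) / p)"
    using pq by (simp add: field_simps)
  also have "\<bar>\<dots>\<bar> \<le> \<bar>(u - v) / p\<bar> + \<bar>(v / q) * ((q - p) / p)\<bar>" by (rule abs_triangle_ineq)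
  also have "\<bar>(u - v) / p\<bar> \<le> a / r"
    using assms pq by (auto simp: abs_divide intro!: frac_le)
  also have "\<bar>(v / q) * ((q - p) / p)\<bar> \<le> 1 * (b / r)"
    unfolding abs_mult
  proof (rule mult_mono)
    show "\<bar>(q - p) / p\<bar> \<le> b / r"
      using assms pq by (auto simp: abs_divide abs_minus_commute intro!: frac_le)
  qed (use assms pq in auto)
  finally show ?thesis by (simp add: add_divide_distrib)
qed

section \<open>Truncated distances and their normalisation\<close>

context proper_metric_group
begin

\<comment> \<open>The truncation at \<open>R\<close> covers the case of an empty complement, which occurs for finite groups.\<close>
definition depth :: "real \<Rightarrow> 'a set \<Rightarrow> 'a \<Rightarrow> real" where
  "depth R T x = Inf (insert R (d x ` (carrier G - T)))"

lemma depth_bdd_below: "bdd_below (insert R (d x ` (carrier G - T)))"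
  by (rule bdd_belowI[of _ "min R 0"]) (auto intro: min.coboundedI2)

lemma depth_le: "depth R T x \<le> R"
  unfolding depth_def by (rule cInf_lower[OF _ depth_bdd_below]) simp

lemma depth_le_dist: "z \<in> carrier G \<Longrightarrow> z \<notin> T \<Longrightarrow> depth R T x \<le> d x z"
  unfolding depth_def by (rule cInf_lower[OF _ depth_bdd_below]) simp

lemma depth_geI: "r \<le> R \<Longrightarrow> (\<And>z. z \<in> carrier G \<Longrightarrow> z \<notin> T \<Longrightarrow> r \<le> d x z) \<Longrightarrow> r \<le> depth R T x"
  unfolding depth_def by (rule cInf_greatest) auto

lemma depth_nonneg: "0 \<le> R \<Longrightarrow> 0 \<le> depth R T x"
  by (rule depth_geI) auto

lemma depth_outside: "0 \<le> R \<Longrightarrow> x \<in> carrier G \<Longrightarrow> x \<notin> T \<Longrightarrow> depth R T x = 0"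
  using depth_le_dist[of x T R x] depth_nonneg[of R T x] by simp

text \<open>An infimum of a constant and of the functions \<open>d x z\<close>, which are
  1-Lipschitz in \<open>x\<close>, is 1-Lipschitz; exchanging \<open>x\<close> and \<open>y\<close>
  gives the other inequality.\<close>

lemma depth_lipschitz:
  assumes "x \<in> carrier G" "y \<in> carrier G"
  shows "depth R T x \<le> depth R T y + d x y"
proof -
  have "depth R T x - d x y \<le> depth R T y"
  proof (rule depth_geI)
    show "depth R T x - d x y \<le> R" using depth_le[of R T x] nonneg[of x y] by linarith
    fix z assume z: "z \<in> carrier G" "z \<notin> T"
    show "depth R T x - d x y \<le> d y z"
      using depth_le_dist[OF z, of R x] triangle[OF assms z(1)] by linarith
  qed
  then show ?thesis by simp
qed

text \<open>The orbit sums \<open>K l\<close> of the depths are maxima, hence invariant under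
  \<open>\<sigma> n\<close> and again 1-Lipschitz. Their total \<open>P\<close> is at least
  \<open>R\<close>, because a translate of some \<open>T l\<close> contains the ball of radius
  \<open>R\<close> about \<open>x\<close>. Dividing 1-Lipschitz functions by so large a denominator
  leaves little variation.\<close>

lemma decay_functions_if_tower:
  assumes H: "\<And>n. subgroup (\<sigma> n) G" and tower: "tower_condition G \<sigma> s"
  shows "decay_function_condition G \<sigma> s"
  unfolding decay_function_condition_def
proof (intro allI impI)
  fix \<epsilon> :: real and M assume \<epsilon>: "\<epsilon> > 0" and M: "finite M" "M \<subseteq> carrier G"
  obtain c where c: "c > 0" "\<And>g. g \<in> M \<Longrightarrow> d \<one> g < c"
    using finite_subset_mball_one[OF M] by blast
  \<comment> \<open>Along \<open>M\<close> the numerator changes by at most \<open>c\<close> and the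
    denominator, a sum of \<open>s + 1\<close> functions, by at most \<open>(s + 1) * c\<close>;
    with denominators at least \<open>R\<close> the quotient changes by at most \<epsilon>.\<close>
  define R where "R = (c + (real s + 1) * c) / \<epsilon>"
  have R: "R > 0" using c(1) \<epsilon> by (simp add: R_def add_pos_pos)
  obtain n T where TG: "\<And>l. l \<le> s \<Longrightarrow> T l \<subseteq> carrier G" and fin: "\<And>l. l \<le> s \<Longrightarrow> finite (T l)"
    and free: "\<And>l. l \<le> s \<Longrightarrow> free_translates G (\<sigma> n) (T l)"
    and T: "\<And>x. x \<in> carrier G \<Longrightarrow> \<exists>l\<le>s. \<exists>h\<in>\<sigma> n. \<forall>g\<in>mball \<one> R. g \<otimes> x \<otimes> h \<in> T l"
    by (rule tower_conditionD[OF tower finite_mball[OF one_closed, of R] mball_subset_mspace])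
      (rule that)
  interpret H: subgroup "\<sigma> n" G by (rule H)
  define F where "F = (\<lambda>l. depth R (T l))"
  define K where "K = (\<lambda>l x. \<Sum>\<^sub>\<infinity>h\<in>\<sigma> n. F l (x \<otimes> h))"
  define P where "P = (\<lambda>x. \<Sum>l\<le>s. K l x)"
  define \<mu> where "\<mu> = (\<lambda>l x. F l x / P x)"
  have F0: "0 \<le> F l x" for l x using R by (simp add: F_def depth_nonneg)
  have Fout: "F l x = 0" if "x \<in> carrier G" "x \<notin> T l" for l x
    using R that by (simp add: F_def depth_outside)
  have Flip: "F l x \<le> F l y + d x y" if "x \<in> carrier G" "y \<in> carrier G" for l x y
    using that by (simp add: F_def depth_lipschitz)
  have K: "\<exists>a\<in>\<sigma> n. K l x = F l (x \<otimes> a) \<and> (\<forall>b\<in>\<sigma> n. F l (x \<otimes> b) \<le> K l x)"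
    if "l \<le> s" "x \<in> carrier G" for l x
    using free_translates_infsum[OF H free[OF that(1)] TG[OF that(1)], of "F l" x] F0 Fout that(2)
    unfolding K_def by metis
  have FK: "F l x \<le> K l x" if "l \<le> s" "x \<in> carrier G" for l x
  proof -
    have "F l (x \<otimes> \<one>) \<le> K l x" using K[OF that] H.one_closed by blast
    then show ?thesis using that by simp
  qed
  have K0: "0 \<le> K l x" if "l \<le> s" "x \<in> carrier G" for l x
    using FK[OF that] F0[of l x] by linarith
  have Klip: "K l x \<le> K l y + d x y" if l: "l \<le> s" and xy: "x \<in> carrier G" "y \<in> carrier G" for l x y
  proof -
    \<comment> \<open>The index attaining the maximum for \<open>x\<close> also bounds
      \<open>K l y\<close> from below, and right-invariance leaves the distance unchanged.\<close>
    obtain a where a: "a \<in> \<sigma> n" "K l x = F l (x \<otimes> a)" using K[OF l xy(1)] by blast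
    have "F l (x \<otimes> a) \<le> F l (y \<otimes> a) + d (x \<otimes> a) (y \<otimes> a)" using xy a by (intro Flip) auto
    moreover have "d (x \<otimes> a) (y \<otimes> a) = d x y" using xy a by (intro dist_mult_right) auto
    moreover have "F l (y \<otimes> a) \<le> K l y" using K[OF l xy(2)] a by blast
    ultimately show ?thesis using a by linarith
  qed
  have Kmono: "K l (x \<otimes> k) \<le> K l x" if l: "l \<le> s" and xk: "x \<in> carrier G" "k \<in> \<sigma> n" for l x k
  proof -
    have "x \<otimes> k \<in> carrier G" using xk by simp
    then obtain a where a: "a \<in> \<sigma> n" "K l (x \<otimes> k) = F l (x \<otimes> k \<otimes> a)" using K[OF l] by blast
    have "F l (x \<otimes> (k \<otimes> a)) \<le> K l x" using K[OF l xk(1)] a xk by blast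
    then show ?thesis using a xk by (simp add: m_assoc)
  qed
  have Kinv: "K l (x \<otimes> k) = K l x" if l: "l \<le> s" and xk: "x \<in> carrier G" "k \<in> \<sigma> n" for l x k
    using Kmono[OF l xk] Kmono[OF l, of "x \<otimes> k" "inv k"] xk by (simp add: m_assoc)
  \<comment> \<open>Invariance of the denominator allows it to be pulled out of the orbit sums of
    \<open>\<mu> l\<close>.\<close>
  have Pinv: "P (x \<otimes> k) = P x" if "x \<in> carrier G" "k \<in> \<sigma> n" for x k
    unfolding P_def using that by (intro sum.cong) (auto simp: Kinv)
  have KP: "K l x \<le> P x" if "l \<le> s" "x \<in> carrier G" for l x
    unfolding P_def using that K0 by (intro member_le_sum) auto
  have FP: "F l x \<le> P x" if "l \<le> s" "x \<in> carrier G" for l x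
    using FK[OF that] KP[OF that] by linarith
  have RP: "R \<le> P x" if x: "x \<in> carrier G" for x
  proof -
    obtain l h where lh: "l \<le> s" "h \<in> \<sigma> n" "\<forall>g\<in>mball \<one> R. g \<otimes> x \<otimes> h \<in> T l" using T[OF x] by blast
    have xh: "x \<otimes> h \<in> carrier G" using x lh by simp
    have "R \<le> F l (x \<otimes> h)"
      unfolding F_def
    proof (rule depth_geI)
      fix z assume z: "z \<in> carrier G" "z \<notin> T l"
      have eq: "z \<otimes> inv (x \<otimes> h) \<otimes> x \<otimes> h = z"
        using z(1) x lh(2) by (simp add: m_assoc inv_mult_group)
      \<comment> \<open>Otherwise \<open>z\<close>, the left translate of
        \<open>x \<otimes> h\<close> by an element of the ball, would lie in
        \<open>T l\<close>.\<close>
      then have "z \<otimes> inv (x \<otimes> h) \<notin> mball \<one> R" using z(2) lh(3) by metis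
      then show "R \<le> d (x \<otimes> h) z" using dist_eq_quotient[OF xh z(1)] z(1) xh by auto
    qed simp
    also have "\<dots> \<le> K l x" using K[OF lh(1) x] lh(2) by blast
    also have "\<dots> \<le> P x" using KP[OF lh(1) x] .
    finally show ?thesis .
  qed
  have Plip: "P x \<le> P y + (real s + 1) * d x y" if "x \<in> carrier G" "y \<in> carrier G" for x y
  proof -
    have "P x \<le> (\<Sum>l\<le>s. K l y + d x y)" unfolding P_def using that by (intro sum_mono) (auto intro: Klip)
    also have "\<dots> = P y + (real s + 1) * d x y" by (simp add: P_def sum.distrib add.commute)
    finally show ?thesis .
  qed
  have supp: "supp_on (carrier G) (\<mu> l) \<subseteq> T l" for l
    using Fout by (auto simp: supp_on_def \<mu>_def)
  have "\<mu> l \<in> carrier G \<rightarrow> {0..1} \<and> finite (supp_on (carrier G) (\<mu> l))" if l: "l \<le> s" for l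
  proof
    show "\<mu> l \<in> carrier G \<rightarrow> {0..1}"
    proof
      fix x assume x: "x \<in> carrier G"
      show "\<mu> l x \<in> {0..1}" using F0[of l x] FP[OF l x] RP[OF x] R by (simp add: \<mu>_def)
    qed
    show "finite (supp_on (carrier G) (\<mu> l))" using supp fin[OF l] by (rule finite_subset)
  qed
  moreover have "supp_on (carrier G) (\<mu> l) \<inter> (supp_on (carrier G) (\<mu> l) #> h) = {}"
    if "l \<le> s" "h \<in> \<sigma> n - {\<one>}" for l h
  proof -
    have "T l \<inter> (T l #> h) = {}" using free[OF that(1)] that(2) by (simp add: free_translates_iff)
    then show ?thesis using supp[of l] unfolding r_coset_def by blast
  qed
  moreover have "(\<Sum>l\<le>s. \<Sum>\<^sub>\<infinity>h\<in>\<sigma> n. \<mu> l (g \<otimes> h)) = 1" if g: "g \<in> carrier G" for g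
  proof -
    have "(\<Sum>\<^sub>\<infinity>h\<in>\<sigma> n. \<mu> l (g \<otimes> h)) = K l g / P g" for l
    proof -
      have "(\<Sum>\<^sub>\<infinity>h\<in>\<sigma> n. \<mu> l (g \<otimes> h)) = (\<Sum>\<^sub>\<infinity>h\<in>\<sigma> n. F l (g \<otimes> h) * inverse (P g))"
        using Pinv[OF g] by (intro infsum_cong) (simp add: \<mu>_def divide_inverse)
      also have "\<dots> = K l g * inverse (P g)" unfolding K_def by (rule infsum_cmult_left')
      finally show ?thesis by (simp add: divide_inverse)
    qed
    then have "(\<Sum>l\<le>s. \<Sum>\<^sub>\<infinity>h\<in>\<sigma> n. \<mu> l (g \<otimes> h)) = P g / P g"
      by (simp add: P_def flip: sum_divide_distrib)
    then show ?thesis using RP[OF g] R by simp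
  qed
  moreover have "(SUP x\<in>carrier G. \<bar>\<mu> l x - \<mu> l (g \<otimes> x)\<bar>) \<le> \<epsilon>" if l: "l \<le> s" and g: "g \<in> M" for l g
  proof (rule cSUP_least)
    show "carrier G \<noteq> {}" using one_closed by blast
    fix x assume x: "x \<in> carrier G"
    have gx: "g \<otimes> x \<in> carrier G" and gG: "g \<in> carrier G" using g M x by auto
    have dist: "d x (g \<otimes> x) \<le> c" "d (g \<otimes> x) x \<le> c"
      using dist_mult_left[OF x gG] c(2)[OF g] commute[of x "g \<otimes> x"] by auto
    have P_dist: "(real s + 1) * d x (g \<otimes> x) \<le> (real s + 1) * c"
      "(real s + 1) * d (g \<otimes> x) x \<le> (real s + 1) * c"
      using dist by (auto intro!: mult_left_mono)
    have "\<bar>\<mu> l x - \<mu> l (g \<otimes> x)\<bar> \<le> (c + (real s + 1) * c) / R"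
      unfolding \<mu>_def
    proof (rule abs_diff_quotient_le[OF R RP[OF x] RP[OF gx] F0 FP[OF l gx]])
      show "\<bar>F l x - F l (g \<otimes> x)\<bar> \<le> c"
        using Flip[OF x gx, of l] Flip[OF gx x, of l] dist by linarith
      show "\<bar>P x - P (g \<otimes> x)\<bar> \<le> (real s + 1) * c"
        using Plip[OF x gx] Plip[OF gx x] P_dist by linarith
    qed
    also have "\<dots> = \<epsilon>" using R \<epsilon> unfolding R_def by (simp add: zero_less_divide_iff)
    finally show "\<bar>\<mu> l x - \<mu> l (g \<otimes> x)\<bar> \<le> \<epsilon>" .
  qed
  ultimately show "\<exists>n. \<exists>\<mu> :: nat \<Rightarrow> 'a \<Rightarrow> real.
           (\<forall>l\<le>s. \<mu> l \<in> carrier G \<rightarrow> {0..1} \<and> finite (supp_on (carrier G) (\<mu> l))) \<and>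
           (\<forall>l\<le>s. \<forall>h\<in>\<sigma> n - {\<one>}.
              supp_on (carrier G) (\<mu> l) \<inter> (supp_on (carrier G) (\<mu> l) #> h) = {}) \<and>
           (\<forall>g\<in>carrier G. (\<Sum>l\<le>s. \<Sum>\<^sub>\<infinity>h\<in>\<sigma> n. \<mu> l (g \<otimes> h)) = 1) \<and>
           (\<forall>l\<le>s. \<forall>g\<in>M. (SUP x\<in>carrier G. \<bar>\<mu> l x - \<mu> l (g \<otimes> x)\<bar>) \<le> \<epsilon>)"
    by (intro exI[of _ n] exI[of _ \<mu>] conjI allI impI ballI) simp_all
qed

end

section \<open>Box spaces\<close>

lemma (in group) conj_class_disjoint_iff:
  assumes "subgroup H G" "g \<in> carrier G"
  shows "H \<inter> (conj_class G g <#> H) = {} \<longleftrightarrow> (\<forall>x\<in>carrier G. x \<otimes> g \<otimes> inv x \<notin> H)"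
proof -
  interpret H: subgroup H G by fact
  have "x \<otimes> g \<otimes> inv x \<in> H"
    if "x \<in> carrier G" "h \<in> H" "x \<otimes> g \<otimes> inv x \<otimes> h \<in> H" for x h
  proof -
    have "x \<otimes> g \<otimes> inv x = x \<otimes> g \<otimes> inv x \<otimes> h \<otimes> inv h" using that assms(2) by (simp add: m_assoc)
    then show ?thesis using that by (metis H.m_closed H.m_inv_closed)
  qed
  then have "x \<notin> H" if "\<forall>x\<in>carrier G. x \<otimes> g \<otimes> inv x \<notin> H" "x \<in> conj_class G g <#> H" for x
    using that unfolding set_mult_def conj_class_def by auto
  moreover have "x \<otimes> g \<otimes> inv x \<in> conj_class G g <#> H" if x: "x \<in> carrier G" for x
  proof -
    have "x \<otimes> g \<otimes> inv x \<in> conj_class G g" using x unfolding conj_class_def by blast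
    then have "x \<otimes> g \<otimes> inv x \<otimes> \<one> \<in> conj_class G g <#> H"
      using H.one_closed unfolding set_mult_def by blast
    then show ?thesis using x assms(2) by simp
  qed
  ultimately show ?thesis by blast
qed

section \<open>Fibres of the box space\<close>

locale box_space_group = proper_metric_group G d for G (structure) and d +
  fixes \<sigma> :: "nat \<Rightarrow> 'a set" and \<rho> :: "nat \<times> 'a set \<Rightarrow> nat \<times> 'a set \<Rightarrow> real"
  assumes decseq: "decseq \<sigma>"
    and finite_index: "finite_index_subgroup G (\<sigma> n)"
    and box_metric: "box_metric G d \<sigma> \<rho>"
begin

sublocale box: Metric_space "box_space G \<sigma>" \<rho>
  using box_metric by (simp add: box_metric_def)

lemma subgroup_seq: "subgroup (\<sigma> n) G"
  using finite_index by (simp add: finite_index_subgroup_def)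

lemma finite_lcosets: "finite (lcosets (\<sigma> n))"
  using finite_index by (simp add: finite_index_subgroup_def)

lemma seq_antimono: "m \<le> n \<Longrightarrow> \<sigma> n \<subseteq> \<sigma> m"
  using decseq by (simp add: decseq_def)

lemma fibre_dist:
  "A \<in> lcosets (\<sigma> n) \<Longrightarrow> B \<in> lcosets (\<sigma> n) \<Longrightarrow> \<rho> (n, A) (n, B) = set_dist d A B"
  using box_metric by (simp add: box_metric_def)

lemma fibre_dist_le:
  assumes "x \<in> carrier G" "y \<in> carrier G"
  shows "\<rho> (n, x <# \<sigma> n) (n, y <# \<sigma> n) \<le> d x y"
  using assms fibre_dist[OF lcoset_in_lcosets lcoset_in_lcosets] lcos_self[OF _ subgroup_seq]
    set_dist_le[of d, OF nonneg] by simp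

text \<open>Properness makes the infimum defining the quotient distance attained, and right
  multiplication by the subgroup moves an attaining pair so that it starts at the prescribed
  representative \<open>x\<close>.\<close>

lemma fibre_dist_lift:
  assumes "x \<in> carrier G" "B \<in> lcosets (\<sigma> n)"
  shows "\<exists>b\<in>B. d x b = \<rho> (n, x <# \<sigma> n) (n, B)"
  using set_dist_attained[OF is_group subgroup_seq proper_metric lcoset_in_lcosets[OF assms(1)]
      assms(2) lcos_self[OF assms(1) subgroup_seq]]
    fibre_dist[OF lcoset_in_lcosets[OF assms(1)] assms(2)] by auto

lemma dist_fibres:
  assumes "C \<le> set_dist \<rho> ({n} \<times> lcosets (\<sigma> n)) ({m} \<times> lcosets (\<sigma> m))"
    "(n, A) \<in> box_space G \<sigma>" "(m, B) \<in> box_space G \<sigma>"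
  shows "C \<le> \<rho> (n, A) (m, B)"
proof -
  have "set_dist \<rho> ({n} \<times> lcosets (\<sigma> n)) ({m} \<times> lcosets (\<sigma> m)) \<le> \<rho> (n, A) (m, B)"
    using assms(2,3) box.nonneg by (intro set_dist_le) (auto simp: box_space_def)
  then show ?thesis using assms(1) by linarith
qed

text \<open>Each element comes with its own index; since \<open>\<sigma>\<close> decreases, the
  largest of these finitely many indices serves all of them.\<close>

lemma semi_conjugacy_separating_finite:
  assumes "semi_conjugacy_separating G \<sigma>" "finite F" "F \<subseteq> carrier G - {\<one>}"
  shows "\<exists>n. \<forall>g\<in>F. \<forall>x\<in>carrier G. x \<otimes> g \<otimes> inv x \<notin> \<sigma> n"
proof -
  have "\<forall>g\<in>F. \<exists>n. \<forall>x\<in>carrier G. x \<otimes> g \<otimes> inv x \<notin> \<sigma> n"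
    using assms(1,3) conj_class_disjoint_iff[OF subgroup_seq]
    unfolding semi_conjugacy_separating_def by (metis DiffE subsetD)
  then obtain k where k: "\<forall>g\<in>F. \<forall>x\<in>carrier G. x \<otimes> g \<otimes> inv x \<notin> \<sigma> (k g)" by metis
  have "\<sigma> (Max (k ` F)) \<subseteq> \<sigma> (k g)" if "g \<in> F" for g
    using that assms(2) by (intro seq_antimono) simp
  then show ?thesis using k by blast
qed

text \<open>By right-invariance \<open>d x (x \<otimes> h)\<close> is the distance from the identity
  to \<open>x \<otimes> h \<otimes> inv x\<close>. If it is below \<open>r\<close>, this conjugate
  lies in a finite ball, and for suitable \<open>n\<close> no element of \<open>\<sigma> n\<close>
  is conjugate to a nontrivial element of that ball. Hence the bound is uniform in
  \<open>x\<close>.\<close>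

lemma displacement_large:
  assumes "semi_conjugacy_separating G \<sigma>"
  obtains n where "\<And>x h. x \<in> carrier G \<Longrightarrow> h \<in> \<sigma> n \<Longrightarrow> d x (x \<otimes> h) < r \<Longrightarrow> h = \<one>"
proof -
  have "finite (mball \<one> r - {\<one>})" "mball \<one> r - {\<one>} \<subseteq> carrier G - {\<one>}"
    using finite_mball[of \<one> r] mball_subset_mspace by auto
  then obtain n where n: "\<forall>g\<in>mball \<one> r - {\<one>}. \<forall>x\<in>carrier G. x \<otimes> g \<otimes> inv x \<notin> \<sigma> n"
    using semi_conjugacy_separating_finite[OF assms] by blast
  have "h = \<one>" if x: "x \<in> carrier G" and h: "h \<in> \<sigma> n" and less: "d x (x \<otimes> h) < r" for x h
  proof (rule ccontr)
    assume "h \<noteq> \<one>"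
    have hG: "h \<in> carrier G" using h subgroup.mem_carrier[OF subgroup_seq] by blast
    let ?g = "x \<otimes> h \<otimes> inv x"
    have conj: "inv x \<otimes> ?g \<otimes> inv (inv x) = h"
      using x hG by (simp add: m_assoc inv_solve_left flip: m_assoc) (simp add: m_assoc)
    have "?g \<noteq> \<one>" using conj \<open>h \<noteq> \<one>\<close> x by auto
    moreover have "d \<one> ?g < r" using dist_eq_quotient[of x "x \<otimes> h"] x hG less by simp
    ultimately have "?g \<in> mball \<one> r - {\<one>}" using x hG by auto
    then have "inv x \<otimes> ?g \<otimes> inv (inv x) \<notin> \<sigma> n" using n x inv_closed by blast
    then show False using conj h by simp
  qed
  then show thesis using that by blast
qed

text \<open>One fibre with large displacement suffices. The traces of the members on it are lifted
  to points near a chosen base point. Distinct points of one coset are far apart, so lifts of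
  bounded sets are unique and compatible with left translation by \<open>M\<close>.\<close>

lemma tower_if_box_space:
  assumes box: "box_space_condition G \<sigma> \<rho> s"
  shows "tower_condition G \<sigma> s"
  unfolding tower_condition_def
proof (intro allI impI)
  fix M assume M: "finite M" "M \<subseteq> carrier G"
  obtain c where c: "c > 0" "\<And>g. g \<in> M \<Longrightarrow> d \<one> g < c"
    using finite_subset_mball_one[OF M] by blast
  have sep: "semi_conjugacy_separating G \<sigma>" and asdim: "asdim (box_space G \<sigma>) \<rho> \<le> enat s"
    using box by (auto simp: box_space_condition_def)
  \<comment> \<open>The cosets of \<open>x\<close> and of the points of \<open>Mx\<close> have
    pairwise distances at most \<open>2 * c\<close>, strictly below this Lebesgue number.\<close>
  have "3 * c > 0" using c by simp
  then obtain \<V> where cov: "cover_of (box_space G \<sigma>) (\<Union>l\<le>s. \<V> l)"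
    and bdd: "uniformly_bounded \<rho> (\<Union>l\<le>s. \<V> l)"
    and leb: "lebesgue_number_at_least (box_space G \<sigma>) \<rho> (\<Union>l\<le>s. \<V> l) (3 * c)"
    and disj: "\<forall>l\<le>s. disjoint (\<V> l)"
    using asdim unfolding asdim_le_iff by blast
  obtain D where D: "D \<ge> 0" "\<And>l V p q. l \<le> s \<Longrightarrow> V \<in> \<V> l \<Longrightarrow> p \<in> V \<Longrightarrow> q \<in> V \<Longrightarrow> \<rho> p q \<le> D"
    using bdd unfolding uniformly_bounded_iff by blast
  have sub: "V \<subseteq> box_space G \<sigma>" if "l \<le> s" "V \<in> \<V> l" for l V
    using cov that unfolding cover_of_def by blast
  \<comment> \<open>Two points within \<open>D\<close> of a base point are at most
    \<open>2 * D\<close> apart, which gives freeness; the extra \<open>c\<close> allows for the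
    displacement by an element of \<open>M\<close> when lifts are compared.\<close>
  obtain n where n: "\<And>x h. x \<in> carrier G \<Longrightarrow> h \<in> \<sigma> n \<Longrightarrow> d x (x \<otimes> h) < 2 * D + c \<Longrightarrow> h = \<one>"
    by (rule displacement_large[OF sep, of "2 * D + c"]) (rule that)
  interpret H: subgroup "\<sigma> n" G by (rule subgroup_seq)
  define fib where "fib = (\<lambda>V :: (nat \<times> 'a set) set. {A. (n, A) \<in> V})"
  \<comment> \<open>Empty traces are dropped because each remaining one needs a base point
    \<open>a P\<close>.\<close>
  define \<P> where "\<P> = (\<lambda>l. fib ` \<V> l - {{}})"
  define a where "a = (\<lambda>P. SOME x. x \<in> carrier G \<and> x <# \<sigma> n \<in> P)"
  define S where "S = (\<lambda>P. {x \<in> carrier G. x <# \<sigma> n \<in> P \<and> d (a P) x \<le> D})"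
  define T where "T = (\<lambda>l. \<Union>P\<in>\<P> l. S P)"
  have P_sub: "P \<subseteq> lcosets (\<sigma> n)" if "l \<le> s" "P \<in> \<P> l" for l P
    using sub that by (force simp: \<P>_def fib_def box_space_def)
  have a: "a P \<in> carrier G \<and> a P <# \<sigma> n \<in> P" if P: "l \<le> s" "P \<in> \<P> l" for l P
  proof -
    obtain A where "A \<in> P" using P(2) by (auto simp: \<P>_def)
    moreover from this obtain x where "x \<in> carrier G" "A = x <# \<sigma> n"
      using lcosets_nonempty[OF subgroup_seq] P_sub[OF P] by blast
    ultimately have "\<exists>x. x \<in> carrier G \<and> x <# \<sigma> n \<in> P" by blast
    then show ?thesis unfolding a_def by (rule someI_ex)
  qed
  have "T l \<subseteq> carrier G" for l by (auto simp: T_def S_def)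
  moreover have "finite (T l)" if l: "l \<le> s" for l
  proof -
    have "finite (\<P> l)"
      using P_sub[OF l] finite_lcosets[of n] by (meson PowI finite_Pow_iff finite_subset subsetI)
    moreover have "finite (S P)" if P: "P \<in> \<P> l" for P
    proof (rule finite_subset)
      show "S P \<subseteq> mball (a P) (D + 1)" using a[OF l P] by (auto simp: S_def)
      show "finite (mball (a P) (D + 1))" using a[OF l P] finite_mball by blast
    qed
    ultimately show ?thesis unfolding T_def by (rule finite_UN_I)
  qed
  moreover have "free_translates G (\<sigma> n) (T l)" if l: "l \<le> s" for l
    unfolding free_translates_def
  proof (intro ballI impI)
    fix x h assume x: "x \<in> T l" and h: "h \<in> \<sigma> n" and xh: "x \<otimes> h \<in> T l"
    obtain P where P: "P \<in> \<P> l" "x \<in> S P" using x by (auto simp: T_def)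
    obtain Q where Q: "Q \<in> \<P> l" "x \<otimes> h \<in> S Q" using xh by (auto simp: T_def)
    have xG: "x \<in> carrier G" using P by (simp add: S_def)
    have meet: "x <# \<sigma> n \<in> P" "x <# \<sigma> n \<in> Q"
      using P(2) Q(2) lcoset_mult_right[OF subgroup_seq xG h] by (auto simp: S_def)
    obtain V where V: "V \<in> \<V> l" "P = fib V" using P(1) by (auto simp: \<P>_def)
    obtain W where W: "W \<in> \<V> l" "Q = fib W" using Q(1) by (auto simp: \<P>_def)
    have "V = W" using disj l V W meet by (auto simp: fib_def disjoint_def)
    then have "P = Q" using V W by simp
    then have "d (a P) x \<le> D" "d (a P) (x \<otimes> h) \<le> D" using P(2) Q(2) by (auto simp: S_def)
    moreover have "d x (x \<otimes> h) \<le> d x (a P) + d (a P) (x \<otimes> h)"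
      using a[OF l P(1)] xG h by (intro triangle) auto
    ultimately show "h = \<one>" using n[OF xG h] c(1) commute[of x "a P"] by simp
  qed
  moreover have "\<exists>l\<le>s. \<exists>h\<in>\<sigma> n. \<forall>g\<in>M. g \<otimes> x \<otimes> h \<in> T l" if x: "x \<in> carrier G" for x
  proof -
    let ?Y = "insert x ((\<lambda>g. g \<otimes> x) ` M)"
    have Y: "?Y \<subseteq> carrier G" using x M by auto
    have near: "d x y \<le> c" if y: "y \<in> ?Y" for y
    proof (cases "y = x")
      case False
      then obtain g where g: "g \<in> M" "y = g \<otimes> x" using y by auto
      have "g \<in> carrier G" using g(1) M(2) by blast
      then have "d x y = d \<one> g" using dist_mult_left x g(2) by simp
      then show ?thesis using c(2)[OF g(1)] by simp
    qed (use x c(1) in simp)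
    let ?S = "(\<lambda>y. (n, y <# \<sigma> n)) ` ?Y"
    have "\<exists>V\<in>\<Union>l\<le>s. \<V> l. ?S \<subseteq> V"
    proof (rule lebesgue_number_at_leastD[OF leb])
      show "?S \<subseteq> box_space G \<sigma>"
      proof (rule image_subsetI)
        fix y assume "y \<in> ?Y"
        then have "y \<in> carrier G" using Y by blast
        then show "(n, y <# \<sigma> n) \<in> box_space G \<sigma>" by (simp add: box_space_def lcoset_in_lcosets)
      qed
      show "\<rho> p q \<le> 2 * c" if pq: "p \<in> ?S" "q \<in> ?S" for p q
      proof -
        obtain y z where yz: "y \<in> ?Y" "p = (n, y <# \<sigma> n)" "z \<in> ?Y" "q = (n, z <# \<sigma> n)"
          using pq by (elim imageE)
        have G: "y \<in> carrier G" "z \<in> carrier G" using Y yz by blast+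
        have "\<rho> p q \<le> d y z" unfolding yz using G by (rule fibre_dist_le)
        also have "\<dots> \<le> d x y + d x z" using triangle[of y x z] commute[of y x] G x by simp
        finally show ?thesis using near[OF yz(1)] near[OF yz(3)] by linarith
      qed
    qed (use c in auto)
    then obtain l V where V: "l \<le> s" "V \<in> \<V> l" "?S \<subseteq> V" by blast
    have in_P: "y <# \<sigma> n \<in> fib V" if "y \<in> ?Y" for y using V(3) that by (auto simp: fib_def)
    have P: "fib V \<in> \<P> l" using V(2) in_P[of x] by (auto simp: \<P>_def)
    define b where "b = a (fib V)"
    have b: "b \<in> carrier G" "b <# \<sigma> n \<in> fib V" using a[OF V(1) P] by (auto simp: b_def)
    have lift: "\<exists>j\<in>\<sigma> n. d b (y \<otimes> j) \<le> D" if y: "y \<in> ?Y" for y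
    proof -
      obtain e where e: "e \<in> y <# \<sigma> n" "d b e = \<rho> (n, b <# \<sigma> n) (n, y <# \<sigma> n)"
        using fibre_dist_lift[OF b(1) lcoset_in_lcosets, of y] Y y by blast
      have "d b e \<le> D" using e(2) D(2)[OF V(1,2)] b(2) in_P[OF y] by (simp add: fib_def)
      then show ?thesis using e(1) by (auto simp: l_coset_def)
    qed
    obtain h where h: "h \<in> \<sigma> n" "d b (x \<otimes> h) \<le> D" using lift[of x] by blast
    have "g \<otimes> x \<otimes> h \<in> T l" if g: "g \<in> M" for g
    proof -
      have gG: "g \<in> carrier G" using g M by blast
      let ?y = "g \<otimes> x \<otimes> h"
      have yG: "?y \<in> carrier G" using gG x h by simp
      \<comment> \<open>The lift near \<open>b\<close> of the coset of \<open>g \<otimes> x\<close>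
        could a priori use another element \<open>j\<close>; a comparison through
        \<open>x \<otimes> h\<close> and \<open>b\<close> shows that \<open>j\<close> equals
        \<open>h\<close>.\<close>
      obtain j where j: "j \<in> \<sigma> n" "d b (g \<otimes> x \<otimes> j) \<le> D" using lift[of "g \<otimes> x"] g by blast
      have yj: "?y \<otimes> (inv h \<otimes> j) = g \<otimes> x \<otimes> j"
      proof -
        have "?y \<otimes> (inv h \<otimes> j) = g \<otimes> x \<otimes> (h \<otimes> inv h) \<otimes> j"
          using gG x h(1) j(1) by (simp add: m_assoc del: r_inv Units_r_inv)
        then show ?thesis using gG x h(1) by simp
      qed
      have "d ?y (?y \<otimes> (inv h \<otimes> j)) < 2 * D + c"
      proof -
        have "d (x \<otimes> h) ?y < c"
          using dist_mult_left[of "x \<otimes> h" g] c(2)[OF g] gG x h(1) by (simp add: m_assoc)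
        moreover have "d ?y b \<le> d ?y (x \<otimes> h) + d (x \<otimes> h) b"
          using x h(1) yG b(1) by (intro triangle) auto
        moreover have "d ?y (g \<otimes> x \<otimes> j) \<le> d ?y b + d b (g \<otimes> x \<otimes> j)"
          using x j(1) yG b(1) gG by (intro triangle) auto
        ultimately show ?thesis
          unfolding yj using h(2) j(2) commute[of ?y "x \<otimes> h"] commute[of b "x \<otimes> h"] by linarith
      qed
      then have "inv h \<otimes> j = \<one>" using n[OF yG] h(1) j(1) by simp
      then have "?y = g \<otimes> x \<otimes> j" using yj yG by simp
      then have "d b ?y \<le> D" using j(2) by simp
      moreover have "?y <# \<sigma> n \<in> fib V"
        using lcoset_mult_right[OF subgroup_seq _ h(1), of "g \<otimes> x"] in_P[of "g \<otimes> x"] g gG x by simp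
      ultimately have "?y \<in> S (fib V)" using yG by (simp add: S_def b_def)
      then show ?thesis using P unfolding T_def by blast
    qed
    then show ?thesis using V(1) h(1) by blast
  qed
  ultimately show "\<exists>n T. (\<forall>l\<le>s. T l \<subseteq> carrier G \<and> finite (T l) \<and> free_translates G (\<sigma> n) (T l)) \<and>
        (\<forall>x\<in>carrier G. \<exists>l\<le>s. \<exists>h\<in>\<sigma> n. \<forall>g\<in>M. g \<otimes> x \<otimes> h \<in> T l)"
    by (intro exI[of _ n] exI[of _ T]) simp
qed

text \<open>For \<open>M\<close> consisting of the identity and \<open>g\<close>, some
  \<open>T l\<close> contains both \<open>inv x \<otimes> h\<close> and
  \<open>g \<otimes> inv x \<otimes> h\<close>. They differ by right multiplication with a conjugate
  of \<open>x \<otimes> g \<otimes> inv x\<close> by an element of \<open>\<sigma> n\<close>; if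
  that lay in \<open>\<sigma> n\<close>, freeness would make it, and so \<open>g\<close>,
  trivial.\<close>

lemma semi_conjugacy_separating_if_tower:
  assumes tower: "tower_condition G \<sigma> s"
  shows "semi_conjugacy_separating G \<sigma>"
  unfolding semi_conjugacy_separating_def
proof
  fix g assume "g \<in> carrier G - {\<one>}"
  then have g: "g \<in> carrier G" "g \<noteq> \<one>" by auto
  obtain n T where free: "\<And>l. l \<le> s \<Longrightarrow> free_translates G (\<sigma> n) (T l)"
    and T: "\<And>x. x \<in> carrier G \<Longrightarrow> \<exists>l\<le>s. \<exists>h\<in>\<sigma> n. \<forall>k\<in>{\<one>, g}. k \<otimes> x \<otimes> h \<in> T l"
    by (rule tower_conditionD[OF tower, of "{\<one>, g}"]) (use g in auto)
  interpret H: subgroup "\<sigma> n" G by (rule subgroup_seq)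
  have "x \<otimes> g \<otimes> inv x \<notin> \<sigma> n" if x: "x \<in> carrier G" for x
  proof
    assume k: "x \<otimes> g \<otimes> inv x \<in> \<sigma> n"
    obtain l h where lh: "l \<le> s" "h \<in> \<sigma> n" "inv x \<otimes> h \<in> T l" "g \<otimes> inv x \<otimes> h \<in> T l"
      using T[of "inv x"] x by auto
    let ?h = "inv h \<otimes> (x \<otimes> g \<otimes> inv x) \<otimes> h"
    have "inv x \<otimes> h \<otimes> ?h = inv x \<otimes> (h \<otimes> inv h) \<otimes> x \<otimes> g \<otimes> inv x \<otimes> h"
      using x g lh(2) by (simp add: m_assoc del: r_inv Units_r_inv)
    also have "\<dots> = g \<otimes> inv x \<otimes> h" using x g lh(2) by simp
    finally have "?h = \<one>"
      using free[OF lh(1)] lh k unfolding free_translates_def by auto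
    then have "(x \<otimes> g \<otimes> inv x) \<otimes> h = h"
      using x g lh(2) inv_solve_left'[of \<one> h "x \<otimes> g \<otimes> inv x \<otimes> h"] by (simp add: m_assoc)
    then have "x \<otimes> g \<otimes> inv x = \<one>" using x g lh(2) by simp
    then show False using x g inv_solve_right'[of \<one> "x \<otimes> g" x] by simp
  qed
  then show "\<exists>n. \<sigma> n \<inter> (conj_class G g <#> \<sigma> n) = {}"
    using conj_class_disjoint_iff[OF subgroup_seq g(1)] by blast
qed

text \<open>Beyond some index each fibre is far from all others, and the translates of
  \<open>T l\<close> project to it with images that are equal or disjoint. The finitely many earlier
  fibres form a finite set, which becomes a single bounded member.\<close>

lemma box_space_asdim_le_if_tower:
  assumes tower: "tower_condition G \<sigma> s"
  shows "asdim (box_space G \<sigma>) \<rho> \<le> enat s"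
  unfolding asdim_le_iff
proof (intro allI impI)
  fix R :: real assume R: "R > 0"
  obtain n0 T where TG: "\<And>l. l \<le> s \<Longrightarrow> T l \<subseteq> carrier G" and fin: "\<And>l. l \<le> s \<Longrightarrow> finite (T l)"
    and free: "\<And>l. l \<le> s \<Longrightarrow> free_translates G (\<sigma> n0) (T l)"
    and T: "\<And>x. x \<in> carrier G \<Longrightarrow> \<exists>l\<le>s. \<exists>h\<in>\<sigma> n0. \<forall>g\<in>mball \<one> R. g \<otimes> x \<otimes> h \<in> T l"
    by (rule tower_conditionD[OF tower finite_mball[OF one_closed, of R] mball_subset_mspace])
      (rule that)
  interpret H: subgroup "\<sigma> n0" G by (rule subgroup_seq)
  obtain N1 where N1: "\<forall>n m. n \<noteq> m \<longrightarrow> n + m \<ge> N1 \<longrightarrow>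
      R \<le> set_dist \<rho> ({n} \<times> lcosets (\<sigma> n)) ({m} \<times> lcosets (\<sigma> m))"
    using box_metric unfolding box_metric_def by blast
  \<comment> \<open>\<open>N1\<close> separates the fibres, and \<open>n0\<close> ensures that
    \<open>\<sigma> n\<close> is contained in \<open>\<sigma> n0\<close>, as disjointness of the
    images requires.\<close>
  define N where "N = max N1 n0"
  have far: "R \<le> \<rho> (n, A) (m, B)"
    if "n \<noteq> m" "n \<ge> N" "(n, A) \<in> box_space G \<sigma>" "(m, B) \<in> box_space G \<sigma>" for n m A B
    using that N1 by (intro dist_fibres) (auto simp: N_def)
  define W where "W = (SIGMA n:{..<N}. lcosets (\<sigma> n))"
  define Q where "Q = (\<lambda>l n k. {n} \<times> (\<lambda>t. (t \<otimes> k) <# \<sigma> n) ` T l)"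
  \<comment> \<open>\<open>W\<close> can join family 0 without a further family, since the images
    all lie in fibres of index at least \<open>N\<close>.\<close>
  define \<V> where "\<V> = (\<lambda>l. (if l = 0 then {W} else {}) \<union> {Q l n k | n k. N \<le> n \<and> k \<in> \<sigma> n0})"
  have V_cases: "V = W \<or> (\<exists>n k. N \<le> n \<and> k \<in> \<sigma> n0 \<and> V = Q l n k)" if "V \<in> \<V> l" for V l
    using that by (auto simp: \<V>_def split: if_splits)
  have W_sub: "W \<subseteq> box_space G \<sigma>" by (auto simp: W_def box_space_def)
  have Q_sub: "Q l n k \<subseteq> box_space G \<sigma>" if "l \<le> s" "k \<in> \<sigma> n0" for l n k
    using TG[OF that(1)] that(2) by (auto simp: Q_def box_space_def intro!: lcoset_in_lcosets)
  have leb: "\<exists>V\<in>\<Union>l\<le>s. \<V> l. S \<subseteq> V"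
    if S: "S \<subseteq> box_space G \<sigma>" "\<And>p q. p \<in> S \<Longrightarrow> q \<in> S \<Longrightarrow> \<rho> p q < R" for S
  proof (cases "S \<subseteq> W")
    case True
    then show ?thesis by (auto simp: \<V>_def)
  next
    case False
    then obtain n A where nA: "(n, A) \<in> S" "(n, A) \<notin> W" by auto
    have A: "A \<in> lcosets (\<sigma> n)" and nN: "n \<ge> N"
      using nA S(1) by (auto simp: box_space_def W_def)
    obtain x where x: "x \<in> carrier G" "A = x <# \<sigma> n" using lcosets_nonempty[OF subgroup_seq A] by blast
    obtain l h where lh: "l \<le> s" "h \<in> \<sigma> n0" "\<forall>g\<in>mball \<one> R. g \<otimes> x \<otimes> h \<in> T l"
      using T[OF x(1)] by blast
    have "(m, B) \<in> Q l n (inv h)" if mB: "(m, B) \<in> S" for m B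
    proof -
      have less: "\<rho> (n, A) (m, B) < R" using S(2)[OF nA(1) mB] .
      \<comment> \<open>Every other fibre is at distance at least \<open>R\<close> from fibre
        \<open>n\<close>, so the set cannot leave this fibre.\<close>
      then have m: "m = n" using far[of n m A B] nN nA(1) mB S(1) by force
      then have B: "B \<in> lcosets (\<sigma> n)" using mB S(1) by (auto simp: box_space_def)
      obtain b where b: "b \<in> B" "d x b = \<rho> (n, x <# \<sigma> n) (n, B)"
        using fibre_dist_lift[OF x(1) B] by blast
      have bG: "b \<in> carrier G" and Bb: "B = b <# \<sigma> n" using lcosets_mem[OF subgroup_seq B b(1)] .
      have "d \<one> (b \<otimes> inv x) < R" using dist_eq_quotient[OF x(1) bG] b(2) less m x(2) by simp
      then have "b \<otimes> inv x \<otimes> x \<otimes> h \<in> T l" using lh(3) x(1) bG by simp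
      then have "b \<otimes> h \<in> T l" using x(1) bG by (simp add: m_assoc)
      moreover have "b \<otimes> h \<otimes> inv h = b" using bG lh(2) by (simp add: m_assoc)
      ultimately show ?thesis unfolding Q_def m Bb by force
    qed
    then have "S \<subseteq> Q l n (inv h)" by auto
    moreover have "Q l n (inv h) \<in> \<V> l" using nN lh(2) by (auto simp: \<V>_def)
    ultimately show ?thesis using lh(1) by blast
  qed
  have "cover_of (box_space G \<sigma>) (\<Union>l\<le>s. \<V> l)"
    unfolding cover_of_def
  proof
    have "V \<subseteq> box_space G \<sigma>" if "l \<le> s" "V \<in> \<V> l" for l V
      using V_cases[OF that(2)] W_sub Q_sub[OF that(1)] by blast
    then show "\<Union> (\<Union>l\<le>s. \<V> l) \<subseteq> box_space G \<sigma>" by blast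
    show "box_space G \<sigma> \<subseteq> \<Union> (\<Union>l\<le>s. \<V> l)"
    proof
      fix p assume "p \<in> box_space G \<sigma>"
      then have "\<exists>V\<in>\<Union>l\<le>s. \<V> l. {p} \<subseteq> V" using R by (intro leb) auto
      then show "p \<in> \<Union> (\<Union>l\<le>s. \<V> l)" by blast
    qed
  qed
  moreover have "uniformly_bounded \<rho> (\<Union>l\<le>s. \<V> l)"
  proof -
    have "finite W" unfolding W_def using finite_lcosets by auto
    then obtain D1 where D1: "D1 \<ge> 0" "\<forall>p\<in>W. \<forall>q\<in>W. \<rho> p q \<le> D1"
      using finite_dist_bounded by blast
    have "finite (\<Union>l\<le>s. T l)" using fin by auto
    then obtain D2 where D2: "D2 \<ge> 0" "\<forall>x\<in>\<Union>l\<le>s. T l. \<forall>y\<in>\<Union>l\<le>s. T l. d x y \<le> D2"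
      using finite_dist_bounded by blast
    have "\<rho> p q \<le> D1 + D2" if l: "l \<le> s" "V \<in> \<V> l" "p \<in> V" "q \<in> V" for l V p q
      using V_cases[OF l(2)]
    proof
      assume "V = W"
      then have "\<rho> p q \<le> D1" using D1(2) l(3,4) by blast
      then show ?thesis using D2(1) by simp
    next
      assume "\<exists>n k. N \<le> n \<and> k \<in> \<sigma> n0 \<and> V = Q l n k"
      then obtain n k t u where k: "k \<in> \<sigma> n0" and t: "t \<in> T l" "p = (n, (t \<otimes> k) <# \<sigma> n)"
        and u: "u \<in> T l" "q = (n, (u \<otimes> k) <# \<sigma> n)"
        using l(3,4) by (auto simp: Q_def)
      have G: "t \<in> carrier G" "u \<in> carrier G" "k \<in> carrier G" using t u k TG[OF l(1)] by auto
      have "\<rho> p q \<le> d (t \<otimes> k) (u \<otimes> k)" unfolding t u using G by (intro fibre_dist_le) auto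
      also have "\<dots> = d t u" using G by (intro dist_mult_right)
      also have "\<dots> \<le> D2" using D2(2) t(1) u(1) l(1) by blast
      finally show ?thesis using D1(1) by simp
    qed
    then show ?thesis
      unfolding uniformly_bounded_iff using D1(1) D2(1) by (intro exI[of _ "D1 + D2"]) auto
  qed
  moreover have "lebesgue_number_at_least (box_space G \<sigma>) \<rho> (\<Union>l\<le>s. \<V> l) R"
    using leb by (rule lebesgue_number_at_leastI)
  moreover have "disjoint (\<V> l)" if l: "l \<le> s" for l
  proof -
    have WQ: "W \<inter> Q l n k = {}" if "N \<le> n" for n k using that by (auto simp: W_def Q_def)
    \<comment> \<open>Different \<open>k\<close> may give the same image, so sharing a point is
      shown to imply inclusion; exchanging the roles yields equality.\<close>
    have QQ: "Q l n k \<subseteq> Q l n' k'"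
      if nk: "N \<le> n" "k \<in> \<sigma> n0" "k' \<in> \<sigma> n0" and z: "z \<in> Q l n k" "z \<in> Q l n' k'" for n k n' k' z
    proof -
      obtain t u where t: "t \<in> T l" "u \<in> T l" "(t \<otimes> k) <# \<sigma> n = (u \<otimes> k') <# \<sigma> n" and n': "n' = n"
        using z by (auto simp: Q_def)
      have G: "t \<in> carrier G" "u \<in> carrier G" using t TG[OF l] by auto
      obtain j where j: "j \<in> \<sigma> n" "u \<otimes> k' = t \<otimes> k \<otimes> j"
        using lcoset_eq_iff[OF subgroup_seq, of "t \<otimes> k" "u \<otimes> k'"] t(3) G nk by auto
      have jn0: "j \<in> \<sigma> n0" using j(1) seq_antimono[of n0 n] nk(1) by (auto simp: N_def)
      have "u = u \<otimes> k' \<otimes> inv k'" using G nk(3) by (simp add: m_assoc)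
      also have "\<dots> = t \<otimes> (k \<otimes> j \<otimes> inv k')" unfolding j(2) using G nk jn0 by (simp add: m_assoc)
      finally have "k \<otimes> j \<otimes> inv k' = \<one>"
        using free[OF l] t(1,2) nk jn0 unfolding free_translates_def by auto
      then have k': "k' = k \<otimes> j" using nk jn0 inv_solve_right'[of \<one> "k \<otimes> j" k'] by simp
      have "(w \<otimes> k) <# \<sigma> n = (w \<otimes> k') <# \<sigma> n" if "w \<in> T l" for w
      proof -
        have "w \<in> carrier G" using that TG[OF l] by blast
        then show ?thesis
          using lcoset_mult_right[OF subgroup_seq _ j(1), of "w \<otimes> k"] nk jn0 by (simp add: k' m_assoc)
      qed
      then show ?thesis by (auto simp: Q_def n')
    qed
    show ?thesis
    proof (rule disjointI)
      fix V V' assume V: "V \<in> \<V> l" "V' \<in> \<V> l" "V \<noteq> V'"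
      have False if z: "z \<in> V" "z \<in> V'" for z
        using V_cases[OF V(1)]
      proof (elim disjE exE conjE)
        assume "V = W"
        then show False using V_cases[OF V(2)] V(3) WQ z by blast
      next
        fix n k assume Q: "N \<le> n" "k \<in> \<sigma> n0" "V = Q l n k"
        show False
          using V_cases[OF V(2)]
        proof (elim disjE exE conjE)
          assume "V' = W"
          then show False using WQ[OF Q(1), of k] Q(3) z by blast
        next
          fix n' k' assume Q': "N \<le> n'" "k' \<in> \<sigma> n0" "V' = Q l n' k'"
          show False
            using QQ[OF Q(1,2) Q'(2), of z n'] QQ[OF Q'(1,2) Q(2), of z n] Q(3) Q'(3) V(3) z by blast
        qed
      qed
      then show "V \<inter> V' = {}" by blast
    qed
  qed
  ultimately show "\<exists>\<V>. cover_of (box_space G \<sigma>) (\<Union>l\<le>s. \<V> l) \<and>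
      uniformly_bounded \<rho> (\<Union>l\<le>s. \<V> l) \<and>
      lebesgue_number_at_least (box_space G \<sigma>) \<rho> (\<Union>l\<le>s. \<V> l) R \<and> (\<forall>l\<le>s. disjoint (\<V> l))"
    by (intro exI[of _ \<V>]) simp
qed

lemma box_space_condition_iff_tower: "box_space_condition G \<sigma> \<rho> s \<longleftrightarrow> tower_condition G \<sigma> s"
  using tower_if_box_space semi_conjugacy_separating_if_tower box_space_asdim_le_if_tower
  unfolding box_space_condition_def by blast

end

theorem lemma2p13:
  fixes G :: "('a, 'b) monoid_scheme"
    and d d' :: "'a \<Rightarrow> 'a \<Rightarrow> real"
    and \<sigma> :: "nat \<Rightarrow> 'a set"
    and \<rho> :: "nat \<times> 'a set \<Rightarrow> nat \<times> 'a set \<Rightarrow> real"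
    and s :: nat
  assumes "group G" and "countable (carrier G)" and "residually_finite G"
    and "proper_right_invariant_metric G d"
    and "decseq \<sigma>" and "\<forall>n. finite_index_subgroup G (\<sigma> n)"
    and "proper_right_invariant_metric G d'" and "box_metric G d' \<sigma> \<rho>"
  shows "(box_space_condition G \<sigma> \<rho> s \<longleftrightarrow> invariant_cover_condition G d \<sigma> s) \<and>
         (invariant_cover_condition G d \<sigma> s \<longleftrightarrow> decay_function_condition G \<sigma> s)"
proof -
  interpret proper_metric_group G d
    using assms by (simp add: proper_metric_group_def proper_metric_group_axioms_def)
  \<comment> \<open>The metric \<open>d'\<close> behind the box space may differ from
    \<open>d\<close>; the conditions are linked only through the tower condition, which mentions
    neither.\<close>
  interpret B: box_space_group G d' \<sigma> \<rho>
    using assms by (simp add: box_space_group_def box_space_group_axioms_def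
        proper_metric_group_def proper_metric_group_axioms_def)
  have "invariant_cover_condition G d \<sigma> s \<longleftrightarrow> tower_condition G \<sigma> s"
    using invariant_cover_if_tower[of \<sigma>, OF B.subgroup_seq]
      tower_if_invariant_cover[of \<sigma>, OF B.finite_index]
    by blast
  moreover have "decay_function_condition G \<sigma> s \<longleftrightarrow> tower_condition G \<sigma> s"
    using decay_functions_if_tower[of \<sigma>, OF B.subgroup_seq]
      tower_if_decay_functions[of \<sigma>, OF B.subgroup_seq]
    by blast
  ultimately show ?thesis using B.box_space_condition_iff_tower by blast
qed

end
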